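(* A (finite-dimensional, symmetric) monoidal category $\mathcal{C}$ of convex operational models is weakly self-dual if and only if it is compact closed and can be equipped with a compact structure (a choice of a dual $(A',\eta_A,\epsilon_A)$ for each object $A$) such that $A' = A$ for all objects $A \in \mathcal{C}$.
   Context: All vector spaces are finite-dimensional and real; $V^*$ is the dual space. A cone is regular if it is closed, convex, pointed and generating. A linear map between ordered vector spaces is positive if it maps the positive cone into the positive cone. A convex operational model (COM) is a triple $(A, A^{\#}, u_A)$, abbreviated $A$, where $A$ is an ordered vector space with regular cone $A_+$, $u_A \in A^*$ is strictly positive on $A_+\setminus\{0\}$, and $A^{\#}$ is the vector space $A^*$ ordered by a chosen regular cone $A^{\#}_+ \subseteq A^*_+ = \{a \in A^* : a(\alpha)\ge 0\ \forall \alpha\in A_+\}$ with $u_A \in A^{\#}_+$. A morphism of COMs $A \to B$ is a positive linear map $\phi: A\to B$ with $\phi^*(B^{\#}_+)\subseteq A^{\#}_+$. These form a category $\mathbf{Com}$. Let $I = (\mathbb{R},\mathbb{R},1)$ with the standard cones. A category of COMs is a subcategory $\mathcal{C}$ of $\mathbf{Com}$ such that each $\mathcal{C}(A,B)$ is a regular sub-cone of the cone of COM morphisms $A \to B$, $I \in \mathcal{C}$, $\mathcal{C}(I,A)\simeq A$ (every $\alpha \in A_+$ is identified with the morphism $t\mapsto t\alpha$, so $\mathcal{C}(I,A)=A_+$), and $\mathcal{C}(A,I)\simeq A^{\#}$ (so $\mathcal{C}(A,I) = A^{\#}_+$). A composite of COMs $A,B$ is a COM $(AB,(AB)^{\#},u_{AB})$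 with $AB$ contained in the space of bilinear forms on $A^{\#}\times B^{\#}$ (hence, as a vector space, $A\otimes B$), $u_{AB} = u_A\otimes u_B$, $\alpha\otimes\beta \in (AB)_+$ for all $\alpha\in A_+,\beta\in B_+$ (where $(\alpha\otimes\beta)(a,b)=a(\alpha)b(\beta)$), and $a\otimes b\in (AB)^{\#}_+$ for all $a\in A^{\#}_+, b\in B^{\#}_+$. A monoidal category of COMs is a category of COMs with a symmetric monoidal structure whose unit is $I$ and in which each $A\otimes B$ is a composite of $A$ and $B$ in this sense. The tensor product of morphisms, the associativity and unit isomorphisms (treated as identities) and the symmetries $\sigma_{A,B}$ are those of the usual tensor product of vector spaces. For $\gamma\in (A\otimes B)_+=\mathcal{C}(I,A\otimes B)$ define $\hat\gamma: A^{\#}\to B$ by $\hat\gamma(a) = (a\otimes 1_B)\circ\gamma$; for $f\in (A\otimes B)^{\#}_+=\mathcal{C}(A\otimes B,I)$ define $\hat f: A\to B^{\#}$ by $\hat f(\alpha) (\beta)=f(\alpha\otimes\beta)$. $\mathcal{C}$ is weakly self-dual if for every $A\in\mathcal{C}$ there is a pair $(\gamma_A,f_A)$ with $\gamma_A \in (A\otimes A)_+$ (a possibly un-normalized bipartite state) and $f_A \in (A\otimes A)^{\#}_+ = \mathcal{C}(A\otimes A, I)$ such that $\gamma_A$ is an isomorphism state, i.e. $\hat\gamma_A: A^{\#}\to A$ is an order-isomorphism (with respect to $A^{\#}_+$ and $A_+$), and $\hat f_A = \hat\gamma_A^{-1}$. A dual for $A$ is a triple $(B,\eta,\epsilon)$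 with $\eta: I\to B\otimes A$, $\epsilon: A\otimes B\to I$ in $\mathcal{C}$ such that $(\epsilon\otimes 1_A)\circ(1_A\otimes\eta)=1_A$ and $(1_B\otimes\epsilon)\circ(\eta\otimes 1_B)=1_B$. $\mathcal{C}$ is compact closed if every object has a dual. *)

theory Defs
  imports "HOL-Analysis.Analysis" "HOL-Library.Function_Algebras"
begin

section \<open>Pointwise vector space structure on functions\<close>

instantiation "fun" :: (type, real_vector) real_vector
begin

definition scaleR_fun :: "real \<Rightarrow> ('a \<Rightarrow> 'b) \<Rightarrow> 'a \<Rightarrow> 'b"
  where "scaleR_fun c f = (\<lambda>x. c *\<^sub>R f x)"

instance
  by standard (simp_all add: fun_eq_iff scaleR_fun_def scaleR_add_left scaleR_add_right)

end

section \<open>Finite-dimensional spaces, linear maps, cones\<close>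

text \<open>
  Vector spaces are finite-dimensional linear subspaces of one ambient normed space of type
  \<open>'v\<close>. The type is arbitrary, and every family of finite-dimensional real vector spaces embeds
  into some normed space, so this is no restriction on the spaces that occur. The norm is used only
  for its topology, which induces the usual topology on each finite-dimensional subspace.
\<close>

definition fin_dim_space :: "'a::real_vector set \<Rightarrow> bool" where
  "fin_dim_space V \<longleftrightarrow> subspace V \<and> (\<exists>B. finite B \<and> span B = V)"

text \<open>
  A linear map defined on \<open>V\<close> is represented by the function that is extended by \<open>0\<close> outside \<open>V\<close>.
  Thus equality of maps is equality of functions, the linear maps \<open>V \<rightarrow> W\<close> form a linear
  subspace of the function type, and composition is the usual composition of functions.
\<close>

definition lin :: "'a::real_vector set \<Rightarrow> 'b::real_vector set \<Rightarrow> ('a \<Rightarrow> 'b) set" where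
  "lin V W = {f. (\<forall>x\<in>V. f x \<in> W) \<and>
                 (\<forall>x\<in>V. \<forall>y\<in>V. f (x + y) = f x + f y) \<and>
                 (\<forall>c. \<forall>x\<in>V. f (c *\<^sub>R x) = c *\<^sub>R f x) \<and>
                 (\<forall>x. x \<notin> V \<longrightarrow> f x = 0)}"

definition dual :: "'a::real_vector set \<Rightarrow> ('a \<Rightarrow> real) set" where
  "dual V = lin V UNIV"

text \<open>Bilinear forms on \<open>V \<times> W\<close>, in curried form.\<close>

definition bilinear_forms ::
  "'a::real_vector set \<Rightarrow> 'b::real_vector set \<Rightarrow> ('a \<Rightarrow> 'b \<Rightarrow> real) set" where
  "bilinear_forms V W = lin V (dual W)"

definition idmap :: "'a::real_vector set \<Rightarrow> 'a \<Rightarrow> 'a" where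
  "idmap V = (\<lambda>x. if x \<in> V then x else 0)"

definition linv :: "'a::real_vector set \<Rightarrow> 'b::real_vector set \<Rightarrow> ('a \<Rightarrow> 'b) \<Rightarrow> 'b \<Rightarrow> 'a" where
  "linv V W f = (\<lambda>y. if y \<in> W then inv_into V f y else 0)"

text \<open>
  Cones of functionals and of linear maps are sets of functions; for these, \<^const>\<open>closed\<close> refers to
  the topology of pointwise convergence, which on the finite-dimensional spaces
  \<^term>\<open>dual V\<close> and \<^term>\<open>lin V W\<close> is the usual topology.
\<close>

definition regular_cone :: "'a::{real_vector, topological_space} set \<Rightarrow> 'a set \<Rightarrow> bool" where
  "regular_cone V K \<longleftrightarrow>
     K \<subseteq> V \<and> closed K \<and> convex_cone K \<and> (\<forall>x\<in>K. - x \<in> K \<longrightarrow> x = 0) \<and> span K = V"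

definition order_isomorphism ::
  "'a::real_vector set \<Rightarrow> 'a set \<Rightarrow> 'b::real_vector set \<Rightarrow> 'b set \<Rightarrow> ('a \<Rightarrow> 'b) \<Rightarrow> bool" where
  "order_isomorphism V K W L f \<longleftrightarrow> f \<in> lin V W \<and> bij_betw f V W \<and> f ` K = L"

section \<open>Convex operational models\<close>

text \<open>
  \<open>spc\<close> is the space \<open>A\<close>, \<open>pcone\<close> the cone \<open>A\<^sub>+\<close>, \<open>econe\<close> the chosen cone of functionals
  (the positive cone of \<open>A\<^sup>#\<close>), and \<open>ounit\<close> the order unit.
\<close>

record 'v com =
  spc :: "'v set"
  pcone :: "'v set"
  econe :: "('v \<Rightarrow> real) set"
  ounit :: "'v \<Rightarrow> real"

definition is_com :: "'v::real_normed_vector com \<Rightarrow> bool" where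
  "is_com A \<longleftrightarrow>
     fin_dim_space (spc A) \<and>
     regular_cone (spc A) (pcone A) \<and>
     ounit A \<in> dual (spc A) \<and>
     (\<forall>\<alpha>\<in>pcone A - {0}. ounit A \<alpha> > 0) \<and>
     regular_cone (dual (spc A)) (econe A) \<and>
     econe A \<subseteq> {a \<in> dual (spc A). \<forall>\<alpha>\<in>pcone A. a \<alpha> \<ge> 0} \<and>
     ounit A \<in> econe A"

definition com_morphisms :: "'v::real_normed_vector com \<Rightarrow> 'v com \<Rightarrow> ('v \<Rightarrow> 'v) set" where
  "com_morphisms A B =
     {\<phi> \<in> lin (spc A) (spc B). \<phi> ` pcone A \<subseteq> pcone B \<and> (\<forall>b\<in>econe B. b \<circ> \<phi> \<in> econe A)}"

text \<open>
  The model \<open>I = (\<real>, \<real>, 1)\<close> has to live in the ambient space: it is the line spanned by a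
  nonzero vector \<open>e\<close>, where \<open>t *\<^sub>R e\<close> stands for the real number \<open>t\<close>.
\<close>

definition coord :: "'v::real_normed_vector \<Rightarrow> 'v \<Rightarrow> real" where
  "coord e x = (if x \<in> span {e} then (THE t. x = t *\<^sub>R e) else 0)"

definition unit_com :: "'v::real_normed_vector \<Rightarrow> 'v com" where
  "unit_com e =
     \<lparr>spc = span {e}, pcone = {t *\<^sub>R e | t. t \<ge> 0}, econe = {t *\<^sub>R coord e | t. t \<ge> 0}, ounit = coord e\<rparr>"

section \<open>Categories of convex operational models\<close>

text \<open>
  \<open>evec\<close> is the vector spanning the model \<open>I\<close>. \<open>tens\<close> is the tensor product of objects, and
  \<open>bform C A B\<close> exhibits the elements of the space of \<open>tens C A B\<close> as bilinear forms
  on \<open>A\<^sup># \<times> B\<^sup>#\<close>. (An embedding is needed because in HOL bilinear forms cannot be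
  literally elements of the ambient type.)
\<close>

record 'v com_cat =
  objs :: "'v com set"
  homs :: "'v com \<Rightarrow> 'v com \<Rightarrow> ('v \<Rightarrow> 'v) set"
  evec :: 'v
  tens :: "'v com \<Rightarrow> 'v com \<Rightarrow> 'v com"
  bform :: "'v com \<Rightarrow> 'v com \<Rightarrow> 'v \<Rightarrow> ('v \<Rightarrow> real) \<Rightarrow> ('v \<Rightarrow> real) \<Rightarrow> real"

definition Iobj :: "'v::real_normed_vector com_cat \<Rightarrow> 'v com" where
  "Iobj C = unit_com (evec C)"

text \<open>The linear map \<open>I \<rightarrow> A\<close>, \<open>t \<mapsto> t \<alpha>\<close>, and the linear map \<open>A \<rightarrow> I\<close> given by a functional \<open>a\<close>.\<close>

definition state_mor :: "'v::real_normed_vector com_cat \<Rightarrow> 'v \<Rightarrow> 'v \<Rightarrow> 'v" where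
  "state_mor C \<alpha> = (\<lambda>x. coord (evec C) x *\<^sub>R \<alpha>)"

definition effect_mor :: "'v::real_normed_vector com_cat \<Rightarrow> ('v \<Rightarrow> real) \<Rightarrow> 'v \<Rightarrow> 'v" where
  "effect_mor C a = (\<lambda>x. a x *\<^sub>R evec C)"

definition category_of_coms :: "'v::real_normed_vector com_cat \<Rightarrow> bool" where
  "category_of_coms C \<longleftrightarrow>
     (\<forall>A\<in>objs C. is_com A) \<and>
     (\<forall>A\<in>objs C. idmap (spc A) \<in> homs C A A) \<and>
     (\<forall>A\<in>objs C. \<forall>B\<in>objs C. \<forall>D\<in>objs C. \<forall>f\<in>homs C A B. \<forall>g\<in>homs C B D. g \<circ> f \<in> homs C A D) \<and>
     (\<forall>A\<in>objs C. \<forall>B\<in>objs C.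
        homs C A B \<subseteq> com_morphisms A B \<and> regular_cone (lin (spc A) (spc B)) (homs C A B)) \<and>
     evec C \<noteq> 0 \<and> Iobj C \<in> objs C \<and>
     (\<forall>A\<in>objs C. homs C (Iobj C) A = state_mor C ` pcone A) \<and>
     (\<forall>A\<in>objs C. homs C A (Iobj C) = effect_mor C ` econe A)"

section \<open>Composites and canonical maps of tensor products\<close>

definition pure :: "'v::real_normed_vector com_cat \<Rightarrow> 'v com \<Rightarrow> 'v com \<Rightarrow> 'v \<Rightarrow> 'v \<Rightarrow> 'v" where
  "pure C A B \<alpha> \<beta> =
     (THE \<omega>. \<omega> \<in> spc (tens C A B) \<and>
             (\<forall>a\<in>dual (spc A). \<forall>b\<in>dual (spc B). bform C A B \<omega> a b = a \<alpha> * b \<beta>))"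

text \<open>The functional \<open>a \<otimes> b\<close> on \<open>A \<otimes> B\<close> is evaluation of bilinear forms at \<open>(a, b)\<close>.\<close>

definition pure_effect ::
  "'v::real_normed_vector com_cat \<Rightarrow> 'v com \<Rightarrow> 'v com \<Rightarrow> ('v \<Rightarrow> real) \<Rightarrow> ('v \<Rightarrow> real) \<Rightarrow> 'v \<Rightarrow> real" where
  "pure_effect C A B a b = (\<lambda>\<omega>. bform C A B \<omega> a b)"

text \<open>
  As \<open>A\<^sub>+\<close> and \<open>B\<^sub>+\<close> are generating, the clause on product states forces the embedding
  \<open>bform C A B\<close> to be onto, so that the space of the composite is the full tensor product.
\<close>

definition is_composite :: "'v::real_normed_vector com_cat \<Rightarrow> 'v com \<Rightarrow> 'v com \<Rightarrow> bool" where
  "is_composite C A B \<longleftrightarrow>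
     is_com (tens C A B) \<and>
     (bform C A B \<in> lin (spc (tens C A B)) (bilinear_forms (dual (spc A)) (dual (spc B))) \<and>
      inj_on (bform C A B) (spc (tens C A B))) \<and>
     (\<forall>\<alpha>\<in>pcone A. \<forall>\<beta>\<in>pcone B. \<exists>\<omega>\<in>pcone (tens C A B).
        \<forall>a\<in>dual (spc A). \<forall>b\<in>dual (spc B). bform C A B \<omega> a b = a \<alpha> * b \<beta>) \<and>
     ounit (tens C A B) = pure_effect C A B (ounit A) (ounit B) \<and>
     (\<forall>a\<in>econe A. \<forall>b\<in>econe B. pure_effect C A B a b \<in> econe (tens C A B))"

definition tmap ::
  "'v::real_normed_vector com_cat \<Rightarrow> 'v com \<Rightarrow> 'v com \<Rightarrow> 'v com \<Rightarrow> 'v com \<Rightarrow>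
     ('v \<Rightarrow> 'v) \<Rightarrow> ('v \<Rightarrow> 'v) \<Rightarrow> 'v \<Rightarrow> 'v" where
  "tmap C A A' B B' f g =
     (THE h. h \<in> lin (spc (tens C A B)) (spc (tens C A' B')) \<and>
             (\<forall>\<alpha>\<in>spc A. \<forall>\<beta>\<in>spc B. h (pure C A B \<alpha> \<beta>) = pure C A' B' (f \<alpha>) (g \<beta>)))"

definition assoc :: "'v::real_normed_vector com_cat \<Rightarrow> 'v com \<Rightarrow> 'v com \<Rightarrow> 'v com \<Rightarrow> 'v \<Rightarrow> 'v" where
  "assoc C A B D =
     (THE h. h \<in> lin (spc (tens C (tens C A B) D)) (spc (tens C A (tens C B D))) \<and>
             (\<forall>\<alpha>\<in>spc A. \<forall>\<beta>\<in>spc B. \<forall>\<delta>\<in>spc D.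
                h (pure C (tens C A B) D (pure C A B \<alpha> \<beta>) \<delta>) =
                pure C A (tens C B D) \<alpha> (pure C B D \<beta> \<delta>)))"

definition lunit :: "'v::real_normed_vector com_cat \<Rightarrow> 'v com \<Rightarrow> 'v \<Rightarrow> 'v" where
  "lunit C A =
     (THE h. h \<in> lin (spc (tens C (Iobj C) A)) (spc A) \<and>
             (\<forall>t. \<forall>\<alpha>\<in>spc A. h (pure C (Iobj C) A (t *\<^sub>R evec C) \<alpha>) = t *\<^sub>R \<alpha>))"

definition runit :: "'v::real_normed_vector com_cat \<Rightarrow> 'v com \<Rightarrow> 'v \<Rightarrow> 'v" where
  "runit C A =
     (THE h. h \<in> lin (spc (tens C A (Iobj C))) (spc A) \<and>
             (\<forall>t. \<forall>\<alpha>\<in>spc A. h (pure C A (Iobj C) \<alpha> (t *\<^sub>R evec C)) = t *\<^sub>R \<alpha>))"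

definition swap :: "'v::real_normed_vector com_cat \<Rightarrow> 'v com \<Rightarrow> 'v com \<Rightarrow> 'v \<Rightarrow> 'v" where
  "swap C A B =
     (THE h. h \<in> lin (spc (tens C A B)) (spc (tens C B A)) \<and>
             (\<forall>\<alpha>\<in>spc A. \<forall>\<beta>\<in>spc B. h (pure C A B \<alpha> \<beta>) = pure C B A \<beta> \<alpha>))"

definition iso_in :: "'v::real_normed_vector com_cat \<Rightarrow> 'v com \<Rightarrow> 'v com \<Rightarrow> ('v \<Rightarrow> 'v) \<Rightarrow> bool" where
  "iso_in C A B f \<longleftrightarrow>
     f \<in> homs C A B \<and>
     (\<exists>g\<in>homs C B A. g \<circ> f = idmap (spc A) \<and> f \<circ> g = idmap (spc B))"

section \<open>Monoidal categories of convex operational models\<close>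

text \<open>
  All structure maps are the canonical ones of the tensor product of vector spaces. Bifunctoriality,
  naturality, the pentagon, triangle and hexagon identities and \<open>\<sigma>\<^sub>B\<^sub>,\<^sub>A \<circ> \<sigma>\<^sub>A\<^sub>,\<^sub>B = 1\<close> are
  therefore identities of multilinear algebra; the conditions to be imposed are that \<open>\<C>\<close> is closed
  under the tensor product and that the canonical isomorphisms are isomorphisms of \<open>\<C>\<close>.
\<close>

definition monoidal_category_of_coms :: "'v::real_normed_vector com_cat \<Rightarrow> bool" where
  "monoidal_category_of_coms C \<longleftrightarrow>
     category_of_coms C \<and>
     (\<forall>A\<in>objs C. \<forall>B\<in>objs C. tens C A B \<in> objs C \<and> is_composite C A B) \<and>
     (\<forall>A\<in>objs C. \<forall>A'\<in>objs C. \<forall>B\<in>objs C. \<forall>B'\<in>objs C. \<forall>f\<in>homs C A A'. \<forall>g\<in>homs C B B'.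
        tmap C A A' B B' f g \<in> homs C (tens C A B) (tens C A' B')) \<and>
     (\<forall>A\<in>objs C. \<forall>B\<in>objs C. \<forall>D\<in>objs C.
        iso_in C (tens C (tens C A B) D) (tens C A (tens C B D)) (assoc C A B D)) \<and>
     (\<forall>A\<in>objs C. iso_in C (tens C (Iobj C) A) A (lunit C A)) \<and>
     (\<forall>A\<in>objs C. iso_in C (tens C A (Iobj C)) A (runit C A)) \<and>
     (\<forall>A\<in>objs C. \<forall>B\<in>objs C. iso_in C (tens C A B) (tens C B A) (swap C A B))"

definition assoc_inv ::
  "'v::real_normed_vector com_cat \<Rightarrow> 'v com \<Rightarrow> 'v com \<Rightarrow> 'v com \<Rightarrow> 'v \<Rightarrow> 'v" where
  "assoc_inv C A B D =
     linv (spc (tens C (tens C A B) D)) (spc (tens C A (tens C B D))) (assoc C A B D)"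

definition lunit_inv :: "'v::real_normed_vector com_cat \<Rightarrow> 'v com \<Rightarrow> 'v \<Rightarrow> 'v" where
  "lunit_inv C A = linv (spc (tens C (Iobj C) A)) (spc A) (lunit C A)"

definition runit_inv :: "'v::real_normed_vector com_cat \<Rightarrow> 'v com \<Rightarrow> 'v \<Rightarrow> 'v" where
  "runit_inv C A = linv (spc (tens C A (Iobj C))) (spc A) (runit C A)"

section \<open>Weak self-duality\<close>

text \<open>
  \<open>\<gamma>\<^sup>^(a) = (a \<otimes> 1\<^sub>B) \<circ> \<gamma>\<close>, where \<open>a\<close> is regarded as a map \<open>A \<rightarrow> I\<close>, \<open>I \<otimes> B\<close> is identified with \<open>B\<close>,
  and the state \<open>\<gamma>\<close> is an element of \<open>A \<otimes> B\<close>.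
\<close>

definition state_hat ::
  "'v::real_normed_vector com_cat \<Rightarrow> 'v com \<Rightarrow> 'v com \<Rightarrow> 'v \<Rightarrow> ('v \<Rightarrow> real) \<Rightarrow> 'v" where
  "state_hat C A B \<gamma> =
     (\<lambda>a. if a \<in> dual (spc A)
          then lunit C B (tmap C A (Iobj C) B B (effect_mor C a) (idmap (spc B)) \<gamma>) else 0)"

definition effect_hat ::
  "'v::real_normed_vector com_cat \<Rightarrow> 'v com \<Rightarrow> 'v com \<Rightarrow> ('v \<Rightarrow> real) \<Rightarrow> 'v \<Rightarrow> 'v \<Rightarrow> real" where
  "effect_hat C A B f =
     (\<lambda>\<alpha> \<beta>. if \<alpha> \<in> spc A \<and> \<beta> \<in> spc B then f (pure C A B \<alpha> \<beta>) else 0)"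

definition isomorphism_state :: "'v::real_normed_vector com_cat \<Rightarrow> 'v com \<Rightarrow> 'v \<Rightarrow> bool" where
  "isomorphism_state C A \<gamma> \<longleftrightarrow>
     order_isomorphism (dual (spc A)) (econe A) (spc A) (pcone A) (state_hat C A A \<gamma>)"

definition weakly_self_dual :: "'v::real_normed_vector com_cat \<Rightarrow> bool" where
  "weakly_self_dual C \<longleftrightarrow>
     (\<forall>A\<in>objs C. \<exists>\<gamma>\<in>pcone (tens C A A). \<exists>f\<in>econe (tens C A A).
        isomorphism_state C A \<gamma> \<and>
        effect_hat C A A f = linv (dual (spc A)) (spc A) (state_hat C A A \<gamma>))"

section \<open>Compact closure\<close>

text \<open>The zigzag identities are written with the canonical isomorphisms made explicit.\<close>

definition is_dual ::
  "'v::real_normed_vector com_cat \<Rightarrow> 'v com \<Rightarrow> 'v com \<Rightarrow> ('v \<Rightarrow> 'v) \<Rightarrow> ('v \<Rightarrow> 'v) \<Rightarrow> bool" where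
  "is_dual C A B \<eta> \<epsilon> \<longleftrightarrow>
     B \<in> objs C \<and>
     \<eta> \<in> homs C (Iobj C) (tens C B A) \<and>
     \<epsilon> \<in> homs C (tens C A B) (Iobj C) \<and>
     lunit C A
       \<circ> tmap C (tens C A B) (Iobj C) A A \<epsilon> (idmap (spc A))
       \<circ> assoc_inv C A B A
       \<circ> tmap C A A (Iobj C) (tens C B A) (idmap (spc A)) \<eta>
       \<circ> runit_inv C A = idmap (spc A) \<and>
     runit C B
       \<circ> tmap C B B (tens C A B) (Iobj C) (idmap (spc B)) \<epsilon>
       \<circ> assoc C B A B
       \<circ> tmap C (Iobj C) (tens C B A) B B \<eta> (idmap (spc B))
       \<circ> lunit_inv C B = idmap (spc B)"

definition compact_closed :: "'v::real_normed_vector com_cat \<Rightarrow> bool" where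
  "compact_closed C \<longleftrightarrow> (\<forall>A\<in>objs C. \<exists>B \<eta> \<epsilon>. is_dual C A B \<eta> \<epsilon>)"

definition compact_structure ::
  "'v::real_normed_vector com_cat \<Rightarrow>
     ('v com \<Rightarrow> 'v com) \<Rightarrow> ('v com \<Rightarrow> 'v \<Rightarrow> 'v) \<Rightarrow> ('v com \<Rightarrow> 'v \<Rightarrow> 'v) \<Rightarrow> bool" where
  "compact_structure C D \<eta> \<epsilon> \<longleftrightarrow> (\<forall>A\<in>objs C. is_dual C A (D A) (\<eta> A) (\<epsilon> A))"

end

theory Submission
  imports Defs
begin

text \<open>
  A unit \<open>I \<rightarrow> A \<otimes> A\<close> is a bipartite state \<open>\<gamma>\<close> and a counit \<open>A \<otimes> A \<rightarrow> I\<close> is a bipartite effect \<open>f\<close>.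
  Evaluating on product vectors, the first zigzag is \<open>\<alpha> \<mapsto> \<gamma>\<^sup>^(f\<^sup>^(\<alpha>))\<close>, and composing the second with a
  functional \<open>a\<close> gives the functional \<open>f\<^sup>^(\<gamma>\<^sup>^(a))\<close>. Hence the zigzag identities say precisely that \<open>\<gamma>\<^sup>^\<close>
  and \<open>f\<^sup>^\<close> are mutually inverse. Both maps are built from morphisms of the category, so they preserve
  the cones, and being mutually inverse they are order isomorphisms.
\<close>

section \<open>Linear maps on subspaces\<close>

text \<open>The data of a composite are an injection into bilinear forms and product states for cone
  vectors only. That its space is the full tensor product has to be derived: the cones generate, so
  product vectors exist for all vectors, and dual bases expand every element in them. The resulting
  universal property is what makes the canonical maps usable, since each is given by a definite
  description and has no value until existence and uniqueness are proved. They are transposes of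
  each other, and the transpose is removed because functionals separate points.\<close>

lemma lin_mem: "f \<in> lin V W \<Longrightarrow> x \<in> V \<Longrightarrow> f x \<in> W"
  and lin_add: "f \<in> lin V W \<Longrightarrow> x \<in> V \<Longrightarrow> y \<in> V \<Longrightarrow> f (x + y) = f x + f y"
  and lin_scale: "f \<in> lin V W \<Longrightarrow> x \<in> V \<Longrightarrow> f (c *\<^sub>R x) = c *\<^sub>R f x"
  and lin_outside: "f \<in> lin V W \<Longrightarrow> x \<notin> V \<Longrightarrow> f x = 0"
  by (auto simp: lin_def)

lemma lin_zero: "f \<in> lin V W \<Longrightarrow> f 0 = 0"
  \<comment> \<open>\<open>V\<close> is an arbitrary set here: if it contains 0, scaling by 0 gives
    the value, and otherwise the default value outside \<open>V\<close> does.\<close>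
  using lin_scale[of f V W 0 0] lin_outside[of f V W 0] by fastforce

lemma lin_sum:
  assumes "f \<in> lin V W" "subspace V" "\<And>i. i \<in> I \<Longrightarrow> x i \<in> V"
  shows "f (\<Sum>i\<in>I. c i *\<^sub>R x i) = (\<Sum>i\<in>I. c i *\<^sub>R f (x i))"
  using assms(3)
proof (induction I rule: infinite_finite_induct)
  case (insert i I)
  then show ?case
    using assms(1,2)
    by (simp add: lin_add[OF assms(1)] lin_scale[OF assms(1)] subspace_scale subspace_sum)
qed (simp_all add: lin_zero[OF assms(1)])

lemma linI:
  assumes "\<And>x. x \<in> V \<Longrightarrow> f x \<in> W"
    and "\<And>x y. x \<in> V \<Longrightarrow> y \<in> V \<Longrightarrow> f (x + y) = f x + f y"
    and "\<And>c x. x \<in> V \<Longrightarrow> f (c *\<^sub>R x) = c *\<^sub>R f x"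
    and "\<And>x. x \<notin> V \<Longrightarrow> f x = 0"
  shows "f \<in> lin V W"
  using assms by (auto simp: lin_def)

lemma subspace_lin: "subspace W \<Longrightarrow> subspace (lin V W)"
  unfolding subspace_def lin_def by (auto simp: scaleR_fun_def algebra_simps)

lemma subspace_dual: "subspace (dual V)"
  unfolding dual_def by (rule subspace_lin) simp

lemma idmap_lin: "subspace V \<Longrightarrow> idmap V \<in> lin V V"
  by (rule linI) (auto simp: idmap_def subspace_add subspace_scale)

lemma idmap_apply: "x \<in> V \<Longrightarrow> idmap V x = x"
  by (simp add: idmap_def)

lemma lin_eqI:
  assumes "f \<in> lin V W" "g \<in> lin V W'" "\<And>x. x \<in> V \<Longrightarrow> f x = g x"
  shows "f = g"
proof
  fix x show "f x = g x"
    using assms(3) lin_outside[OF assms(1)] lin_outside[OF assms(2)] by (cases "x \<in> V") auto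
qed

section \<open>Dual bases of finite-dimensional spaces\<close>

text \<open>The functionals are the coordinates of a basis drawn from a finite spanning set. Only
  the expansion of vectors is recorded, not the values on the basis itself: the expansion alone
  yields separation of points and the expansion of functionals and of tensors.\<close>

lemma dual_basis:
  assumes "fin_dim_space V"
  obtains E :: "'a::real_vector set" and \<phi>
  where "finite E" "E \<subseteq> V" "\<And>e. e \<in> E \<Longrightarrow> \<phi> e \<in> dual V"
    "\<And>x. x \<in> V \<Longrightarrow> (\<Sum>e\<in>E. \<phi> e x *\<^sub>R e) = x"
proof -
  obtain B where B: "finite B" "span B = V" and V: "subspace V"
    using assms by (auto simp: fin_dim_space_def)
  obtain E where E: "E \<subseteq> B" "independent E" "B \<subseteq> span E"
    using maximal_independent_subset[of B] by blast
  have sp: "span E = V"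
    using E B by (metis span_mono span_span subset_antisym)
  \<comment> \<open>Coordinates are cut off outside \<open>V\<close> to fit the convention of
    \<open>lin\<close>.\<close>
  define \<phi> where "\<phi> e x = (if x \<in> V then representation E x e else 0)" for e x
  show thesis
  proof
    show "finite E" using E B finite_subset by blast
    show "E \<subseteq> V" using sp span_superset by blast
    show "\<phi> e \<in> dual V" if "e \<in> E" for e
      unfolding dual_def
      by (rule linI)
        (use V in \<open>auto simp: \<phi>_def subspace_add subspace_scale
            representation_add[OF E(2), unfolded sp] representation_scale[OF E(2), unfolded sp]\<close>)
    show "(\<Sum>e\<in>E. \<phi> e x *\<^sub>R e) = x" if "x \<in> V" for x
      using sum_representation_eq[OF E(2), of x E] \<open>finite E\<close> that sp by (simp add: \<phi>_def)
  qed
qed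

text \<open>Applying \<open>a\<close> to the expansion of a vector exhibits the numbers
  \<open>a e\<close> as the coefficients of \<open>a\<close> in the dual basis.\<close>

lemma dual_expand:
  assumes "E \<subseteq> V" "subspace V" "\<And>e. e \<in> E \<Longrightarrow> \<phi> e \<in> dual V"
    "\<And>x. x \<in> V \<Longrightarrow> (\<Sum>e\<in>E. \<phi> e x *\<^sub>R e) = x"
    and a: "a \<in> dual V"
  shows "a = (\<Sum>e\<in>E. a e *\<^sub>R \<phi> e)"
proof (rule lin_eqI)
  show "a \<in> lin V UNIV" using a by (simp add: dual_def)
  show "(\<Sum>e\<in>E. a e *\<^sub>R \<phi> e) \<in> lin V UNIV"
    using assms(3) subspace_dual[of V] unfolding dual_def[symmetric]
    by (intro subspace_sum subspace_scale) auto
  show "a x = (\<Sum>e\<in>E. a e *\<^sub>R \<phi> e) x" if "x \<in> V" for x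
  proof -
    have "a x = a (\<Sum>e\<in>E. \<phi> e x *\<^sub>R e)" using assms(4) that by simp
    also have "\<dots> = (\<Sum>e\<in>E. \<phi> e x *\<^sub>R a e)"
      using a assms(1,2) by (intro lin_sum[of a V UNIV]) (auto simp: dual_def)
    finally have *: "a x = (\<Sum>e\<in>E. \<phi> e x *\<^sub>R a e)" .
    have "(\<Sum>e\<in>F. a e *\<^sub>R \<phi> e) x = (\<Sum>e\<in>F. a e * \<phi> e x)" for F
      by (induction F rule: infinite_finite_induct) (auto simp: scaleR_fun_def)
    then show ?thesis using * by (simp add: mult.commute)
  qed
qed

lemma dual_separates:
  assumes "fin_dim_space V" "x \<in> V" "y \<in> V" "\<And>a. a \<in> dual V \<Longrightarrow> a x = a y"
  shows "x = y"
proof -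
  obtain E \<phi> where E: "finite E" "E \<subseteq> V" "\<And>e. e \<in> E \<Longrightarrow> \<phi> e \<in> dual V"
    "\<And>x. x \<in> V \<Longrightarrow> (\<Sum>e\<in>E. \<phi> e x *\<^sub>R e) = x"
    using dual_basis[OF assms(1)] by metis
  have "x = (\<Sum>e\<in>E. \<phi> e x *\<^sub>R e)" using E assms by simp
  also have "\<dots> = (\<Sum>e\<in>E. \<phi> e y *\<^sub>R e)" using E(3) assms(4) by (intro sum.cong) auto
  also have "\<dots> = y" using E assms by simp
  finally show ?thesis .
qed

section \<open>Bilinear maps, and the coordinate on the unit model\<close>

text \<open>Nothing is required outside \<open>V\<close> and \<open>W\<close>, so that formulas such
  as \<open>coord (evec C) x *\<^sub>R \<alpha>\<close>, which need not vanish there, qualify as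
  they stand.\<close>

definition bilin ::
  "'a::real_vector set \<Rightarrow> 'b::real_vector set \<Rightarrow> 'c::real_vector set \<Rightarrow> ('a \<Rightarrow> 'b \<Rightarrow> 'c) \<Rightarrow> bool"
  where
  "bilin V W X k \<longleftrightarrow>
     (\<forall>x\<in>V. \<forall>y\<in>W. k x y \<in> X) \<and>
     (\<forall>x\<in>V. \<forall>x'\<in>V. \<forall>y\<in>W. k (x + x') y = k x y + k x' y) \<and>
     (\<forall>x\<in>V. \<forall>y\<in>W. \<forall>y'\<in>W. k x (y + y') = k x y + k x y') \<and>
     (\<forall>c. \<forall>x\<in>V. \<forall>y\<in>W. k (c *\<^sub>R x) y = c *\<^sub>R k x y) \<and>
     (\<forall>c. \<forall>x\<in>V. \<forall>y\<in>W. k x (c *\<^sub>R y) = c *\<^sub>R k x y)"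

lemma bilinD:
  assumes "bilin V W X k" "x \<in> V" "y \<in> W"
  shows "k x y \<in> X"
    and "x' \<in> V \<Longrightarrow> k (x + x') y = k x y + k x' y"
    and "y' \<in> W \<Longrightarrow> k x (y + y') = k x y + k x y'"
    and "k (c *\<^sub>R x) y = c *\<^sub>R k x y"
    and "k x (c *\<^sub>R y) = c *\<^sub>R k x y"
  using assms by (auto simp: bilin_def)

lemma bilinI:
  assumes "\<And>x y. x \<in> V \<Longrightarrow> y \<in> W \<Longrightarrow> k x y \<in> X"
    and "\<And>x x' y. x \<in> V \<Longrightarrow> x' \<in> V \<Longrightarrow> y \<in> W \<Longrightarrow> k (x + x') y = k x y + k x' y"
    and "\<And>x y y'. x \<in> V \<Longrightarrow> y \<in> W \<Longrightarrow> y' \<in> W \<Longrightarrow> k x (y + y') = k x y + k x y'"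
    and "\<And>c x y. x \<in> V \<Longrightarrow> y \<in> W \<Longrightarrow> k (c *\<^sub>R x) y = c *\<^sub>R k x y"
    and "\<And>c x y. x \<in> V \<Longrightarrow> y \<in> W \<Longrightarrow> k x (c *\<^sub>R y) = c *\<^sub>R k x y"
  shows "bilin V W X k"
  using assms by (auto simp: bilin_def)

lemma bilin_sum:
  assumes k: "bilin V W X k" and "subspace V" "subspace W" and "0 \<in> X"
    and "I \<subseteq> V" "J \<subseteq> W"
  shows "k (\<Sum>i\<in>I. c i *\<^sub>R i) (\<Sum>j\<in>J. d j *\<^sub>R j) = (\<Sum>i\<in>I. \<Sum>j\<in>J. (c i * d j) *\<^sub>R k i j)"
proof -
  have "k (\<Sum>i\<in>I. c i *\<^sub>R i) y = (\<Sum>i\<in>I. c i *\<^sub>R k i y)" if "y \<in> W" for y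
  proof -
    \<comment> \<open>With one argument fixed, the map is cut off to become an element of
      \<open>lin\<close>, so that the sum rule for linear maps applies.\<close>
    let ?f = "\<lambda>x. if x \<in> V then k x y else 0"
    have f: "?f \<in> lin V X"
      by (rule linI) (use that assms in \<open>auto simp: bilinD[OF k] subspace_add subspace_scale\<close>)
    have "?f (\<Sum>i\<in>I. c i *\<^sub>R i) = (\<Sum>i\<in>I. c i *\<^sub>R ?f i)"
      using assms(5) by (intro lin_sum[OF f assms(2)]) auto
    moreover have "(\<Sum>i\<in>I. c i *\<^sub>R i) \<in> V"
      using assms by (intro subspace_sum subspace_scale) auto
    ultimately show ?thesis using assms by (simp add: subset_iff)
  qed
  moreover have "k x (\<Sum>j\<in>J. d j *\<^sub>R j) = (\<Sum>j\<in>J. d j *\<^sub>R k x j)" if "x \<in> V" for x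
  proof -
    let ?f = "\<lambda>y. if y \<in> W then k x y else 0"
    have f: "?f \<in> lin W X"
      by (rule linI) (use that assms in \<open>auto simp: bilinD[OF k] subspace_add subspace_scale\<close>)
    have "?f (\<Sum>j\<in>J. d j *\<^sub>R j) = (\<Sum>j\<in>J. d j *\<^sub>R ?f j)"
      using assms(6) by (intro lin_sum[OF f assms(3)]) auto
    moreover have "(\<Sum>j\<in>J. d j *\<^sub>R j) \<in> W"
      using assms by (intro subspace_sum subspace_scale) auto
    ultimately show ?thesis using assms by (simp add: subset_iff)
  qed
  moreover have "(\<Sum>j\<in>J. d j *\<^sub>R j) \<in> W"
    using assms by (intro subspace_sum subspace_scale) auto
  ultimately show ?thesis
    using assms(5) by (auto simp: scaleR_right.sum intro!: sum.cong)
qed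

lemma coord_scaleR: "e \<noteq> 0 \<Longrightarrow> coord e (t *\<^sub>R e) = t"
  proof -
  assume e: "e \<noteq> 0"
  have "(THE s. t *\<^sub>R e = s *\<^sub>R e) = t"
    by (rule the_equality) (use e in simp_all)
  then show ?thesis by (simp add: coord_def span_base span_scale)
qed

lemma coord_lin:
  assumes e: "e \<noteq> 0"
  shows "coord e \<in> lin (span {e}) UNIV"
proof (rule linI)
  fix x assume "x \<in> span {e}"
  then obtain s where x: "x = s *\<^sub>R e" by (auto simp: span_singleton)
  then show "coord e (c *\<^sub>R x) = c *\<^sub>R coord e x" for c
    by (simp add: coord_scaleR[OF e])
  fix y assume "y \<in> span {e}"
  then obtain t where y: "y = t *\<^sub>R e" by (auto simp: span_singleton)
  show "coord e (x + y) = coord e x + coord e y"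
    using x y by (simp add: coord_scaleR[OF e] flip: scaleR_left_distrib)
qed (auto simp: coord_def)

section \<open>The tensor product of convex operational models\<close>

locale monoidal_coms =
  fixes C :: "'v::real_normed_vector com_cat"
  assumes monoidal: "monoidal_category_of_coms C"
begin

abbreviation T where "T A B \<equiv> spc (tens C A B)"

section \<open>Consequences of the axioms, and maps given by states and effects\<close>

lemma category: "category_of_coms C"
  using monoidal by (simp add: monoidal_category_of_coms_def)

lemma com: "A \<in> objs C \<Longrightarrow> is_com A"
  using category by (simp add: category_of_coms_def)

lemma fin_dim: "A \<in> objs C \<Longrightarrow> fin_dim_space (spc A)"
  using com by (simp add: is_com_def)

lemma subspace_spc: "A \<in> objs C \<Longrightarrow> subspace (spc A)"
  using fin_dim by (simp add: fin_dim_space_def)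

lemma pcone_spc:
  assumes "A \<in> objs C"
  shows "\<alpha> \<in> pcone A \<Longrightarrow> \<alpha> \<in> spc A"
proof -
  have "pcone A \<subseteq> spc A" using com[OF assms] by (simp add: is_com_def regular_cone_def)
  then show "\<alpha> \<in> pcone A \<Longrightarrow> \<alpha> \<in> spc A" by (rule subsetD)
qed

lemma econe_dual:
  assumes "A \<in> objs C"
  shows "a \<in> econe A \<Longrightarrow> a \<in> dual (spc A)"
proof -
  have "econe A \<subseteq> dual (spc A)" using com[OF assms] by (simp add: is_com_def regular_cone_def)
  then show "a \<in> econe A \<Longrightarrow> a \<in> dual (spc A)" by (rule subsetD)
qed

lemma tens_obj: "A \<in> objs C \<Longrightarrow> B \<in> objs C \<Longrightarrow> tens C A B \<in> objs C"
  and composite: "A \<in> objs C \<Longrightarrow> B \<in> objs C \<Longrightarrow> is_composite C A B"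
  using monoidal by (simp_all add: monoidal_category_of_coms_def)

lemma Iobj_obj: "Iobj C \<in> objs C" and evec_nz: "evec C \<noteq> 0"
  using category by (simp_all add: category_of_coms_def)

lemma spc_Iobj: "spc (Iobj C) = span {evec C}"
  by (simp add: Iobj_def unit_com_def)

lemma evec_spc: "evec C \<in> spc (Iobj C)"
  by (simp add: spc_Iobj span_base)

lemma homs_lin: "A \<in> objs C \<Longrightarrow> B \<in> objs C \<Longrightarrow> f \<in> homs C A B \<Longrightarrow> f \<in> lin (spc A) (spc B)"
  using category unfolding category_of_coms_def com_morphisms_def by blast

lemma homs_comp:
  assumes "A \<in> objs C" "B \<in> objs C" "D \<in> objs C" "f \<in> homs C A B" "g \<in> homs C B D"
  shows "g \<circ> f \<in> homs C A D"
proof -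
  have "\<forall>A\<in>objs C. \<forall>B\<in>objs C. \<forall>D\<in>objs C. \<forall>f\<in>homs C A B. \<forall>g\<in>homs C B D. g \<circ> f \<in> homs C A D"
    using category unfolding category_of_coms_def by (elim conjE)
  then show ?thesis using assms by simp
qed

lemma homs_from_I: "A \<in> objs C \<Longrightarrow> homs C (Iobj C) A = state_mor C ` pcone A"
  and homs_to_I: "A \<in> objs C \<Longrightarrow> homs C A (Iobj C) = effect_mor C ` econe A"
  and homs_id: "A \<in> objs C \<Longrightarrow> idmap (spc A) \<in> homs C A A"
  using category by (simp_all add: category_of_coms_def)

lemma homs_tmap:
  assumes "A \<in> objs C" "A' \<in> objs C" "B \<in> objs C" "B' \<in> objs C"
    and "f \<in> homs C A A'" "g \<in> homs C B B'"
  shows "tmap C A A' B B' f g \<in> homs C (tens C A B) (tens C A' B')"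
proof -
  have "\<forall>A\<in>objs C. \<forall>A'\<in>objs C. \<forall>B\<in>objs C. \<forall>B'\<in>objs C. \<forall>f\<in>homs C A A'. \<forall>g\<in>homs C B B'.
      tmap C A A' B B' f g \<in> homs C (tens C A B) (tens C A' B')"
    using monoidal unfolding monoidal_category_of_coms_def by (elim conjE)
  then show ?thesis using assms by simp
qed

lemma effect_mor_lin:
  assumes "a \<in> dual V"
  shows "effect_mor C a \<in> lin V (spc (Iobj C))"
proof -
  have a: "a \<in> lin V UNIV" using assms by (simp add: dual_def)
  show ?thesis
    by (rule linI)
      (auto simp: effect_mor_def lin_add[OF a] lin_scale[OF a] lin_outside[OF a] spc_Iobj span_base
        span_scale scaleR_left_distrib)
qed

lemma state_mor_lin:
  assumes "subspace V" "\<alpha> \<in> V"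
  shows "state_mor C \<alpha> \<in> lin (spc (Iobj C)) V"
proof -
  note c = coord_lin[OF evec_nz]
  show ?thesis
    using assms
    by (intro linI)
      (auto simp: state_mor_def spc_Iobj lin_add[OF c] lin_scale[OF c] lin_outside[OF c]
        subspace_scale scaleR_left_distrib)
qed

lemma state_mor_evec: "state_mor C \<alpha> (evec C) = \<alpha>"
  using coord_scaleR[OF evec_nz, of 1] by (simp add: state_mor_def)

section \<open>Elements of a tensor product as bilinear forms\<close>

lemma bform_lin:
  assumes "A \<in> objs C" "B \<in> objs C"
  shows "bform C A B \<in> lin (T A B) (lin (dual (spc A)) (dual (dual (spc B))))"
    and "inj_on (bform C A B) (T A B)"
  using composite[OF assms] by (simp_all add: is_composite_def bilinear_forms_def)

lemma bform_bilin:
  assumes "A \<in> objs C" "B \<in> objs C" "\<omega> \<in> T A B"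
  shows "bform C A B \<omega> \<in> lin (dual (spc A)) (dual (dual (spc B)))"
  using lin_mem[OF bform_lin(1)[OF assms(1,2)] assms(3)] .

lemma bform_add:
  "A \<in> objs C \<Longrightarrow> B \<in> objs C \<Longrightarrow> \<omega> \<in> T A B \<Longrightarrow> \<omega>' \<in> T A B \<Longrightarrow>
    bform C A B (\<omega> + \<omega>') a b = bform C A B \<omega> a b + bform C A B \<omega>' a b"
  by (simp add: lin_add[OF bform_lin(1)])

lemma bform_scale:
  "A \<in> objs C \<Longrightarrow> B \<in> objs C \<Longrightarrow> \<omega> \<in> T A B \<Longrightarrow>
    bform C A B (c *\<^sub>R \<omega>) a b = c * bform C A B \<omega> a b"
  by (simp add: lin_scale[OF bform_lin(1)] scaleR_fun_def)

text \<open>Injectivity of the embedding reduces equality to equality of forms, and forms vanish off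
  the dual spaces, so agreement on functionals is enough.\<close>

lemma tensor_eqI:
  assumes "A \<in> objs C" "B \<in> objs C" "\<omega> \<in> T A B" "\<omega>' \<in> T A B"
    and "\<And>a b. a \<in> dual (spc A) \<Longrightarrow> b \<in> dual (spc B) \<Longrightarrow> bform C A B \<omega> a b = bform C A B \<omega>' a b"
  shows "\<omega> = \<omega>'"
proof -
  have "bform C A B \<omega> = bform C A B \<omega>'"
  proof (rule lin_eqI[OF bform_bilin bform_bilin])
    show "bform C A B \<omega> a = bform C A B \<omega>' a" if "a \<in> dual (spc A)" for a
      by (rule lin_eqI[of _ "dual (spc B)" UNIV _ UNIV])
        (use lin_mem[OF bform_bilin[OF assms(1,2)] that] assms that in \<open>auto simp: dual_def[of "dual _"]\<close>)
  qed (use assms in auto)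
  then show ?thesis using bform_lin(2)[OF assms(1,2)] assms by (auto dest: inj_onD)
qed

text \<open>Product states provide the elements for cone vectors. Since the cones span and the
  condition on the form is linear in each factor, linear combinations of witnesses serve for all
  vectors, one factor at a time.\<close>

lemma pure_ex:
  assumes "A \<in> objs C" "B \<in> objs C" "\<alpha> \<in> spc A" "\<beta> \<in> spc B"
  shows "\<exists>\<omega>\<in>T A B. \<forall>a\<in>dual (spc A). \<forall>b\<in>dual (spc B). bform C A B \<omega> a b = a \<alpha> * b \<beta>"
    (is "?P \<alpha> \<beta>")
proof -
  have A: "subspace (spc A)" and B: "subspace (spc B)" and T: "subspace (T A B)"
    using assms(1,2) subspace_spc tens_obj by auto
  have sA: "spc A = span (pcone A)" and sB: "spc B = span (pcone B)"
    using com assms(1,2) by (simp_all add: is_com_def regular_cone_def)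
  note dual_simps = lin_add[of _ _ UNIV] lin_scale[of _ _ UNIV] lin_zero[of _ _ UNIV]
  have base: "?P x y" if "x \<in> pcone A" "y \<in> pcone B" for x y
    using composite[OF assms(1,2)] that pcone_spc[OF tens_obj[OF assms(1,2)]]
    unfolding is_composite_def by blast
  \<comment> \<open>The second vector stays in its cone for now. Membership of the first is carried
    through the induction because functionals are additive only on the space.\<close>
  have left: "x \<in> spc A \<and> ?P x y" if x: "x \<in> spc A" and y: "y \<in> pcone B" for x y
    using x[unfolded sA]
  proof (induction rule: span_induct_alt)
    case base
    then show ?case
      using subspace_0[OF A] subspace_0[OF B] subspace_0[OF T] lin_zero[OF bform_lin(1)[OF assms(1,2)]]
      by (intro conjI bexI[of _ 0]) (auto simp: dual_def dual_simps)
  next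
    case (step c x z)
    then obtain \<omega> \<omega>' where "\<omega> \<in> T A B" "\<omega>' \<in> T A B"
      "\<forall>a\<in>dual (spc A). \<forall>b\<in>dual (spc B). bform C A B \<omega> a b = a x * b y"
      "\<forall>a\<in>dual (spc A). \<forall>b\<in>dual (spc B). bform C A B \<omega>' a b = a z * b y"
      using base[of x y] y by auto
    moreover have "x \<in> spc A" "z \<in> spc A" using step pcone_spc[OF assms(1)] by auto
    ultimately show ?case
      using T A assms(1,2)
      by (intro conjI bexI[of _ "c *\<^sub>R \<omega> + \<omega>'"])
        (auto simp: bform_add bform_scale dual_def dual_simps subspace_add subspace_scale algebra_simps)
  qed
  have "\<beta> \<in> spc B \<and> ?P \<alpha> \<beta>"
    using assms(4)[unfolded sB]
  proof (induction rule: span_induct_alt)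
    case base
    then show ?case
      using subspace_0[OF A] subspace_0[OF B] subspace_0[OF T] lin_zero[OF bform_lin(1)[OF assms(1,2)]]
      by (intro conjI bexI[of _ 0]) (auto simp: dual_def dual_simps)
  next
    case (step c y z)
    then obtain \<omega> \<omega>' where "\<omega> \<in> T A B" "\<omega>' \<in> T A B"
      "\<forall>a\<in>dual (spc A). \<forall>b\<in>dual (spc B). bform C A B \<omega> a b = a \<alpha> * b y"
      "\<forall>a\<in>dual (spc A). \<forall>b\<in>dual (spc B). bform C A B \<omega>' a b = a \<alpha> * b z"
      using left[OF assms(3), of y] by auto
    moreover have "y \<in> spc B" "z \<in> spc B" using step pcone_spc[OF assms(2)] by auto
    ultimately show ?case
      using T B assms(1,2)
      by (intro conjI bexI[of _ "c *\<^sub>R \<omega> + \<omega>'"])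
        (auto simp: bform_add bform_scale dual_def dual_simps subspace_add subspace_scale algebra_simps)
  qed
  then show ?thesis ..
qed

lemma
  assumes "A \<in> objs C" "B \<in> objs C" "\<alpha> \<in> spc A" "\<beta> \<in> spc B"
  shows pure_mem: "pure C A B \<alpha> \<beta> \<in> T A B"
    and bform_pure: "a \<in> dual (spc A) \<Longrightarrow> b \<in> dual (spc B) \<Longrightarrow> bform C A B (pure C A B \<alpha> \<beta>) a b = a \<alpha> * b \<beta>"
proof -
  have "\<exists>!\<omega>. \<omega> \<in> T A B \<and> (\<forall>a\<in>dual (spc A). \<forall>b\<in>dual (spc B). bform C A B \<omega> a b = a \<alpha> * b \<beta>)"
    using pure_ex[OF assms] tensor_eqI[OF assms(1,2)] by fastforce
  from theI'[OF this] show "pure C A B \<alpha> \<beta> \<in> T A B"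
    "a \<in> dual (spc A) \<Longrightarrow> b \<in> dual (spc B) \<Longrightarrow> bform C A B (pure C A B \<alpha> \<beta>) a b = a \<alpha> * b \<beta>"
    by (auto simp: pure_def)
qed

lemma pure_bilin:
  assumes "A \<in> objs C" "B \<in> objs C"
  shows "bilin (spc A) (spc B) (T A B) (pure C A B)"
proof -
  have A: "subspace (spc A)" and B: "subspace (spc B)" and T: "subspace (T A B)"
    using assms(1,2) subspace_spc tens_obj by auto
  have d: "a (x + y) = a x + a y" "a (c *\<^sub>R x) = c * a x"
    if "a \<in> dual V" "x \<in> V" "y \<in> V" for a c x y and V :: "'v set"
    using that by (simp_all add: dual_def lin_add lin_scale)
  show ?thesis
    by (rule bilinI; (rule tensor_eqI[OF assms])?)
      (use assms A B T in \<open>auto simp: pure_mem bform_pure bform_add bform_scale d subspace_add subspace_scale algebra_simps\<close>)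
qed

text \<open>The coefficients are the values of the form at pairs of coordinate functionals.
  Expanding arbitrary \<open>a\<close> and \<open>b\<close> in the dual bases shows that both sides
  are the same form, so the space is spanned by product vectors.\<close>

lemma tensor_expand:
  assumes "A \<in> objs C" "B \<in> objs C"
    and E: "finite E" "E \<subseteq> spc A" "\<And>e. e \<in> E \<Longrightarrow> \<phi> e \<in> dual (spc A)"
    "\<And>x. x \<in> spc A \<Longrightarrow> (\<Sum>e\<in>E. \<phi> e x *\<^sub>R e) = x"
    and F: "finite F" "F \<subseteq> spc B" "\<And>e. e \<in> F \<Longrightarrow> \<psi> e \<in> dual (spc B)"
    "\<And>x. x \<in> spc B \<Longrightarrow> (\<Sum>e\<in>F. \<psi> e x *\<^sub>R e) = x"
    and "\<omega> \<in> T A B"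
  shows "(\<Sum>e\<in>E. \<Sum>f\<in>F. bform C A B \<omega> (\<phi> e) (\<psi> f) *\<^sub>R pure C A B e f) = \<omega>"
proof (rule tensor_eqI[OF assms(1,2) _ assms(11)])
  have T: "subspace (T A B)" using subspace_spc[OF tens_obj[OF assms(1,2)]] .
  show mem: "(\<Sum>e\<in>E. \<Sum>f\<in>F. bform C A B \<omega> (\<phi> e) (\<psi> f) *\<^sub>R pure C A B e f) \<in> T A B"
    using T E(2) F(2) assms(1,2) by (intro subspace_sum subspace_scale) (auto intro!: pure_mem)
  fix a b assume ab: "a \<in> dual (spc A)" "b \<in> dual (spc B)"
  \<comment> \<open>This is the functional given by the pair \<open>a\<close>, \<open>b\<close>, cut
    off outside the tensor product so that it passes through the sum as a linear map.\<close>
  define ev where "ev \<omega>' = (if \<omega>' \<in> T A B then bform C A B \<omega>' a b else 0)" for \<omega>'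
  have ev: "ev \<in> lin (T A B) UNIV"
    using T assms(1,2)
    by (intro linI) (auto simp: ev_def bform_add bform_scale subspace_add subspace_scale)
  let ?p = "\<lambda>p. bform C A B \<omega> (\<phi> (fst p)) (\<psi> (snd p))"
  have "ev (\<Sum>p\<in>E \<times> F. ?p p *\<^sub>R pure C A B (fst p) (snd p))
      = (\<Sum>p\<in>E \<times> F. ?p p *\<^sub>R ev (pure C A B (fst p) (snd p)))"
    using E(2) F(2) assms(1,2) by (intro lin_sum[OF ev T]) (auto intro!: pure_mem)
  also have "\<dots> = (\<Sum>p\<in>E \<times> F. ?p p * (a (fst p) * b (snd p)))"
    using E(2) F(2) assms(1,2) ab
    by (intro sum.cong) (auto simp: ev_def pure_mem bform_pure subset_iff)
  finally have 1: "ev (\<Sum>e\<in>E. \<Sum>f\<in>F. bform C A B \<omega> (\<phi> e) (\<psi> f) *\<^sub>R pure C A B e f)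
      = (\<Sum>e\<in>E. \<Sum>f\<in>F. bform C A B \<omega> (\<phi> e) (\<psi> f) * (a e * b f))"
    by (simp add: sum.cartesian_product case_prod_unfold)
  have aeq: "a = (\<Sum>e\<in>E. a e *\<^sub>R \<phi> e)" and beq: "b = (\<Sum>f\<in>F. b f *\<^sub>R \<psi> f)"
    using dual_expand[OF E(2) subspace_spc E(3,4) ab(1)] dual_expand[OF F(2) subspace_spc F(3,4) ab(2)]
      assms(1,2) by auto
  have bl: "bform C A B \<omega> \<in> lin (dual (spc A)) (dual (dual (spc B)))"
    by (rule bform_bilin[OF assms(1,2,11)])
  have "bform C A B \<omega> a = bform C A B \<omega> (\<Sum>e\<in>E. a e *\<^sub>R \<phi> e)"
    by (rule arg_cong[OF aeq])
  also have "\<dots> = (\<Sum>e\<in>E. a e *\<^sub>R bform C A B \<omega> (\<phi> e))"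
    by (rule lin_sum[OF bl subspace_dual E(3)])
  finally have "bform C A B \<omega> a = (\<Sum>e\<in>E. a e *\<^sub>R bform C A B \<omega> (\<phi> e))" .
  moreover have "(\<Sum>e\<in>E. a e *\<^sub>R bform C A B \<omega> (\<phi> e)) b = (\<Sum>e\<in>E. a e * bform C A B \<omega> (\<phi> e) b)"
    using E(1) by (induction E) (auto simp: scaleR_fun_def)
  moreover have "bform C A B \<omega> (\<phi> e) b = (\<Sum>f\<in>F. b f * bform C A B \<omega> (\<phi> e) (\<psi> f))" if "e \<in> E" for e
  proof -
    have "bform C A B \<omega> (\<phi> e) \<in> lin (dual (spc B)) UNIV"
      using lin_mem[OF bl E(3)[OF that]] by (simp add: dual_def[of "dual _"])
    from lin_sum[OF this subspace_dual, of F \<psi> b] F(3) show ?thesis by (simp add: beq[symmetric])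
  qed
  ultimately have "bform C A B \<omega> a b = (\<Sum>e\<in>E. \<Sum>f\<in>F. bform C A B \<omega> (\<phi> e) (\<psi> f) * (a e * b f))"
    by (simp add: sum_distrib_left mult_ac)
  then show "bform C A B (\<Sum>e\<in>E. \<Sum>f\<in>F. bform C A B \<omega> (\<phi> e) (\<psi> f) *\<^sub>R pure C A B e f) a b = bform C A B \<omega> a b"
    using 1 mem by (simp add: ev_def)
qed

text \<open>No case for scalars is needed: a scalar is absorbed into the first factor, so the
  expansion is already a sum of product vectors.\<close>

lemma tensor_induct [consumes 3, case_names pure add]:
  assumes "A \<in> objs C" "B \<in> objs C" "\<omega> \<in> T A B"
    and pure: "\<And>\<alpha> \<beta>. \<alpha> \<in> spc A \<Longrightarrow> \<beta> \<in> spc B \<Longrightarrow> P (pure C A B \<alpha> \<beta>)"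
    and add: "\<And>\<omega> \<omega>'. \<omega> \<in> T A B \<Longrightarrow> \<omega>' \<in> T A B \<Longrightarrow> P \<omega> \<Longrightarrow> P \<omega>' \<Longrightarrow> P (\<omega> + \<omega>')"
  shows "P \<omega>"
proof -
  have A: "subspace (spc A)" and B: "subspace (spc B)" and T: "subspace (T A B)"
    using assms(1,2) subspace_spc tens_obj by auto
  obtain E \<phi> where E: "finite E" "E \<subseteq> spc A" "\<And>e. e \<in> E \<Longrightarrow> \<phi> e \<in> dual (spc A)"
    "\<And>x. x \<in> spc A \<Longrightarrow> (\<Sum>e\<in>E. \<phi> e x *\<^sub>R e) = x"
    using dual_basis[OF fin_dim[OF assms(1)]] by metis
  obtain F \<psi> where F: "finite F" "F \<subseteq> spc B" "\<And>e. e \<in> F \<Longrightarrow> \<psi> e \<in> dual (spc B)"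
    "\<And>x. x \<in> spc B \<Longrightarrow> (\<Sum>e\<in>F. \<psi> e x *\<^sub>R e) = x"
    using dual_basis[OF fin_dim[OF assms(2)]] by metis
  have scaled: "P (c *\<^sub>R pure C A B x y)" if "x \<in> spc A" "y \<in> spc B" for c x y
    using pure[of "c *\<^sub>R x" y] that bilinD(4)[OF pure_bilin[OF assms(1,2)]] A
    by (simp add: subspace_scale)
  have zero: "P 0"
    using scaled[of 0 0 0] subspace_0[OF A] subspace_0[OF B] by simp
  have closed: "P (sum g X)" if "\<And>x. x \<in> X \<Longrightarrow> g x \<in> T A B \<and> P (g x)" "finite X"
    for g :: "'v \<Rightarrow> 'v" and X
    using that(2,1)
    by (induction X) (auto simp: zero intro!: add subspace_sum[OF T])
  have "P (\<Sum>e\<in>E. \<Sum>f\<in>F. bform C A B \<omega> (\<phi> e) (\<psi> f) *\<^sub>R pure C A B e f)"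
    using E(2) F(2) assms(1,2)
    by (intro closed conjI scaled subspace_sum[OF T] subspace_scale[OF T] pure_mem E(1) F(1)) auto
  then show ?thesis
    using tensor_expand[OF assms(1,2) E F assms(3)] by simp
qed

text \<open>The uniqueness half of the universal property.\<close>

lemma tensor_lin_eqI:
  assumes "A \<in> objs C" "B \<in> objs C" "h \<in> lin (T A B) X" "h' \<in> lin (T A B) X'"
    and "\<And>\<alpha> \<beta>. \<alpha> \<in> spc A \<Longrightarrow> \<beta> \<in> spc B \<Longrightarrow> h (pure C A B \<alpha> \<beta>) = h' (pure C A B \<alpha> \<beta>)"
  shows "h = h'"
proof (rule lin_eqI[OF assms(3,4)])
  show "h \<omega> = h' \<omega>" if "\<omega> \<in> T A B" for \<omega>
    using assms(1,2) that
    by (induction rule: tensor_induct) (use assms in \<open>auto simp: lin_add\<close>)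
qed

text \<open>The existence half of the universal property. A choice of bases is made only to write
  the map down; on a product vector the double sum collapses by bilinearity.\<close>

lemma tensor_lift:
  assumes "A \<in> objs C" "B \<in> objs C" "bilin (spc A) (spc B) X k" and X: "subspace X"
  shows "\<exists>h\<in>lin (T A B) X. \<forall>\<alpha>\<in>spc A. \<forall>\<beta>\<in>spc B. h (pure C A B \<alpha> \<beta>) = k \<alpha> \<beta>"
proof -
  have A: "subspace (spc A)" and B: "subspace (spc B)" and T: "subspace (T A B)"
    using assms(1,2) subspace_spc tens_obj by auto
  obtain E \<phi> where E: "finite E" "E \<subseteq> spc A" "\<And>e. e \<in> E \<Longrightarrow> \<phi> e \<in> dual (spc A)"
    "\<And>x. x \<in> spc A \<Longrightarrow> (\<Sum>e\<in>E. \<phi> e x *\<^sub>R e) = x"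
    using dual_basis[OF fin_dim[OF assms(1)]] by metis
  obtain F \<psi> where F: "finite F" "F \<subseteq> spc B" "\<And>e. e \<in> F \<Longrightarrow> \<psi> e \<in> dual (spc B)"
    "\<And>x. x \<in> spc B \<Longrightarrow> (\<Sum>e\<in>F. \<psi> e x *\<^sub>R e) = x"
    using dual_basis[OF fin_dim[OF assms(2)]] by metis
  \<comment> \<open>The expansion into product vectors, with each basis product replaced by its
    prescribed image. Linearity is inherited from the coefficients.\<close>
  define h where "h \<omega> = (if \<omega> \<in> T A B
      then \<Sum>e\<in>E. \<Sum>f\<in>F. bform C A B \<omega> (\<phi> e) (\<psi> f) *\<^sub>R k e f else 0)" for \<omega>
  show ?thesis
  proof (intro bexI ballI)
    have "(\<Sum>e\<in>E. \<Sum>f\<in>F. bform C A B \<omega> (\<phi> e) (\<psi> f) *\<^sub>R k e f) \<in> X" for \<omega>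
      using E(2) F(2) by (intro subspace_sum subspace_scale X bilinD(1)[OF assms(3)]) auto
    then show "h \<in> lin (T A B) X"
      using T assms(1,2)
      by (intro linI)
        (auto simp: h_def bform_add bform_scale subspace_add subspace_scale scaleR_left_distrib
          sum.distrib scaleR_right.sum)
  next
    fix \<alpha> \<beta> assume m: "\<alpha> \<in> spc A" "\<beta> \<in> spc B"
    have "h (pure C A B \<alpha> \<beta>) = (\<Sum>e\<in>E. \<Sum>f\<in>F. (\<phi> e \<alpha> * \<psi> f \<beta>) *\<^sub>R k e f)"
      using m assms(1,2) E(3) F(3) by (simp add: h_def pure_mem bform_pure)
    also have "\<dots> = k (\<Sum>e\<in>E. \<phi> e \<alpha> *\<^sub>R e) (\<Sum>f\<in>F. \<psi> f \<beta> *\<^sub>R f)"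
      using bilin_sum[OF assms(3) A B subspace_0[OF X] E(2) F(2)] by simp
    finally show "h (pure C A B \<alpha> \<beta>) = k \<alpha> \<beta>" using m E(4) F(4) by simp
  qed
qed

section \<open>The canonical maps on product vectors\<close>

text \<open>The universal property makes the definite description well defined. Linear maps suffice
  as factors, which covers functionals outside the cones.\<close>

lemma
  assumes o: "A \<in> objs C" "A' \<in> objs C" "B \<in> objs C" "B' \<in> objs C"
    and fg: "f \<in> lin (spc A) (spc A')" "g \<in> lin (spc B) (spc B')"
  shows tmap_lin: "tmap C A A' B B' f g \<in> lin (T A B) (T A' B')"
    and tmap_pure: "\<alpha> \<in> spc A \<Longrightarrow> \<beta> \<in> spc B \<Longrightarrow>
      tmap C A A' B B' f g (pure C A B \<alpha> \<beta>) = pure C A' B' (f \<alpha>) (g \<beta>)"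
proof -
  have "bilin (spc A) (spc B) (T A' B') (\<lambda>\<alpha> \<beta>. pure C A' B' (f \<alpha>) (g \<beta>))"
    by (rule bilinI)
      (auto simp: lin_add[OF fg(1)] lin_add[OF fg(2)] lin_scale[OF fg(1)] lin_scale[OF fg(2)]
        lin_mem[OF fg(1)] lin_mem[OF fg(2)] bilinD[OF pure_bilin[OF o(2,4)]])
  from tensor_lift[OF o(1,3) this subspace_spc[OF tens_obj[OF o(2,4)]]]
  obtain h where h: "h \<in> lin (T A B) (T A' B')"
    "\<forall>\<alpha>\<in>spc A. \<forall>\<beta>\<in>spc B. h (pure C A B \<alpha> \<beta>) = pure C A' B' (f \<alpha>) (g \<beta>)"
    by blast
  have "\<exists>!h. h \<in> lin (T A B) (T A' B') \<and>
      (\<forall>\<alpha>\<in>spc A. \<forall>\<beta>\<in>spc B. h (pure C A B \<alpha> \<beta>) = pure C A' B' (f \<alpha>) (g \<beta>))"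
  proof (rule ex1I[of _ h], goal_cases)
    case (2 h')
    show ?case
      by (rule tensor_lin_eqI[OF o(1,3), of _ "T A' B'" _ "T A' B'"]) (use 2 h in auto)
  qed (use h in simp)
  from theI'[OF this] show "tmap C A A' B B' f g \<in> lin (T A B) (T A' B')"
    "\<alpha> \<in> spc A \<Longrightarrow> \<beta> \<in> spc B \<Longrightarrow>
      tmap C A A' B B' f g (pure C A B \<alpha> \<beta>) = pure C A' B' (f \<alpha>) (g \<beta>)"
    by (auto simp: tmap_def)
qed

lemma
  assumes A: "A \<in> objs C"
  shows lunit_lin: "lunit C A \<in> lin (T (Iobj C) A) (spc A)"
    and lunit_pure: "\<alpha> \<in> spc A \<Longrightarrow> lunit C A (pure C (Iobj C) A (t *\<^sub>R evec C) \<alpha>) = t *\<^sub>R \<alpha>"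
proof -
  note c = coord_lin[OF evec_nz]
  \<comment> \<open>Scalar multiplication, with vectors of the unit model read as numbers through
    \<open>coord\<close>.\<close>
  have b: "bilin (spc (Iobj C)) (spc A) (spc A) (\<lambda>x \<alpha>. coord (evec C) x *\<^sub>R \<alpha>)"
    by (rule bilinI)
      (auto simp: spc_Iobj lin_add[OF c] lin_scale[OF c] subspace_scale[OF subspace_spc[OF A]]
        algebra_simps)
  obtain h where "h \<in> lin (T (Iobj C) A) (spc A)"
    "\<forall>x\<in>spc (Iobj C). \<forall>\<alpha>\<in>spc A. h (pure C (Iobj C) A x \<alpha>) = coord (evec C) x *\<^sub>R \<alpha>"
    using tensor_lift[OF Iobj_obj A b subspace_spc[OF A]] by blast
  then have h: "h \<in> lin (T (Iobj C) A) (spc A) \<and>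
      (\<forall>t. \<forall>\<alpha>\<in>spc A. h (pure C (Iobj C) A (t *\<^sub>R evec C) \<alpha>) = t *\<^sub>R \<alpha>)"
    by (auto simp: coord_scaleR[OF evec_nz] spc_Iobj span_base span_scale)
  have "\<exists>!h. h \<in> lin (T (Iobj C) A) (spc A) \<and>
      (\<forall>t. \<forall>\<alpha>\<in>spc A. h (pure C (Iobj C) A (t *\<^sub>R evec C) \<alpha>) = t *\<^sub>R \<alpha>)"
  proof (rule ex1I[of _ h], goal_cases)
    case (2 h')
    show ?case
      by (rule tensor_lin_eqI[OF Iobj_obj A, of _ "spc A" _ "spc A"])
        \<comment> \<open>The unit model is the line spanned by \<open>evec C\<close>, so the
          prescribed values cover all product vectors.\<close>
        (use 2 h in \<open>auto simp: spc_Iobj span_singleton\<close>)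
  qed (rule h)
  from theI'[OF this] show "lunit C A \<in> lin (T (Iobj C) A) (spc A)"
    "\<alpha> \<in> spc A \<Longrightarrow> lunit C A (pure C (Iobj C) A (t *\<^sub>R evec C) \<alpha>) = t *\<^sub>R \<alpha>"
    by (auto simp: lunit_def)
qed

lemma
  assumes A: "A \<in> objs C"
  shows runit_lin: "runit C A \<in> lin (T A (Iobj C)) (spc A)"
    and runit_pure: "\<alpha> \<in> spc A \<Longrightarrow> runit C A (pure C A (Iobj C) \<alpha> (t *\<^sub>R evec C)) = t *\<^sub>R \<alpha>"
proof -
  note c = coord_lin[OF evec_nz]
  have b: "bilin (spc A) (spc (Iobj C)) (spc A) (\<lambda>\<alpha> x. coord (evec C) x *\<^sub>R \<alpha>)"
    by (rule bilinI)
      (auto simp: spc_Iobj lin_add[OF c] lin_scale[OF c] subspace_scale[OF subspace_spc[OF A]]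
        algebra_simps)
  obtain h where "h \<in> lin (T A (Iobj C)) (spc A)"
    "\<forall>\<alpha>\<in>spc A. \<forall>x\<in>spc (Iobj C). h (pure C A (Iobj C) \<alpha> x) = coord (evec C) x *\<^sub>R \<alpha>"
    using tensor_lift[OF A Iobj_obj b subspace_spc[OF A]] by blast
  then have h: "h \<in> lin (T A (Iobj C)) (spc A) \<and>
      (\<forall>t. \<forall>\<alpha>\<in>spc A. h (pure C A (Iobj C) \<alpha> (t *\<^sub>R evec C)) = t *\<^sub>R \<alpha>)"
    by (auto simp: coord_scaleR[OF evec_nz] spc_Iobj span_base span_scale)
  have "\<exists>!h. h \<in> lin (T A (Iobj C)) (spc A) \<and>
      (\<forall>t. \<forall>\<alpha>\<in>spc A. h (pure C A (Iobj C) \<alpha> (t *\<^sub>R evec C)) = t *\<^sub>R \<alpha>)"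
  proof (rule ex1I[of _ h], goal_cases)
    case (2 h')
    show ?case
      by (rule tensor_lin_eqI[OF A Iobj_obj, of _ "spc A" _ "spc A"])
        (use 2 h in \<open>auto simp: spc_Iobj span_singleton\<close>)
  qed (rule h)
  from theI'[OF this] show "runit C A \<in> lin (T A (Iobj C)) (spc A)"
    "\<alpha> \<in> spc A \<Longrightarrow> runit C A (pure C A (Iobj C) \<alpha> (t *\<^sub>R evec C)) = t *\<^sub>R \<alpha>"
    by (auto simp: runit_def)
qed

text \<open>Values are prescribed on triple products only, so the universal property is used twice:
  first for the inner pair with the third vector fixed, then for the outer pair.\<close>

lemma
  assumes o: "A \<in> objs C" "B \<in> objs C" "D \<in> objs C"
  shows assoc_lin: "assoc C A B D \<in> lin (T (tens C A B) D) (T A (tens C B D))"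
    and assoc_pure: "\<alpha> \<in> spc A \<Longrightarrow> \<beta> \<in> spc B \<Longrightarrow> \<delta> \<in> spc D \<Longrightarrow>
      assoc C A B D (pure C (tens C A B) D (pure C A B \<alpha> \<beta>) \<delta>) =
      pure C A (tens C B D) \<alpha> (pure C B D \<beta> \<delta>)"
proof -
  let ?X = "T A (tens C B D)"
  note AB = tens_obj[OF o(1,2)] and BD = tens_obj[OF o(2,3)]
  have X: "subspace ?X" and D: "subspace (spc D)" using subspace_spc tens_obj o BD by auto
  note p1 = bilinD[OF pure_bilin[OF o(1) BD]] and p2 = bilinD[OF pure_bilin[OF o(2,3)]]
  have "\<exists>h\<in>lin (T A B) ?X. \<forall>\<alpha>\<in>spc A. \<forall>\<beta>\<in>spc B.
      h (pure C A B \<alpha> \<beta>) = pure C A (tens C B D) \<alpha> (pure C B D \<beta> \<delta>)" if "\<delta> \<in> spc D" for \<delta>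
    by (rule tensor_lift[OF o(1,2) _ X], rule bilinI) (use that in \<open>auto simp: p1 p2\<close>)
  then obtain G where G: "\<And>\<delta>. \<delta> \<in> spc D \<Longrightarrow> G \<delta> \<in> lin (T A B) ?X"
    "\<And>\<alpha> \<beta> \<delta>. \<alpha> \<in> spc A \<Longrightarrow> \<beta> \<in> spc B \<Longrightarrow> \<delta> \<in> spc D \<Longrightarrow>
      G \<delta> (pure C A B \<alpha> \<beta>) = pure C A (tens C B D) \<alpha> (pure C B D \<beta> \<delta>)"
    by metis
  \<comment> \<open>\<open>G\<close> was chosen separately for each \<delta>, so its linearity in
    \<delta> is not automatic. It holds on product vectors, where the values are prescribed, and
    extends by induction.\<close>
  have "bilin (T A B) (spc D) ?X (\<lambda>\<omega> \<delta>. G \<delta> \<omega>)"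
  proof (rule bilinI)
    fix \<omega> \<delta> \<delta>' and c :: real assume m: "\<omega> \<in> T A B" "\<delta> \<in> spc D"
    show "G (c *\<^sub>R \<delta>) \<omega> = c *\<^sub>R G \<delta> \<omega>"
      using o(1,2) m(1)
      by (induction rule: tensor_induct)
        (use m D in \<open>auto simp: G(2) lin_add[OF G(1)] p1 p2 subspace_scale scaleR_add_right\<close>)
    assume m': "\<delta>' \<in> spc D"
    show "G (\<delta> + \<delta>') \<omega> = G \<delta> \<omega> + G \<delta>' \<omega>"
      using o(1,2) m(1)
      by (induction rule: tensor_induct)
        (use m m' D in \<open>auto simp: G(2) lin_add[OF G(1)] p1 p2 subspace_add\<close>)
  qed (auto simp: lin_mem[OF G(1)] lin_add[OF G(1)] lin_scale[OF G(1)])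
  from tensor_lift[OF AB o(3) this X] obtain h where h: "h \<in> lin (T (tens C A B) D) ?X"
    "\<forall>\<omega>\<in>T A B. \<forall>\<delta>\<in>spc D. h (pure C (tens C A B) D \<omega> \<delta>) = G \<delta> \<omega>" by blast
  have "\<exists>!h. h \<in> lin (T (tens C A B) D) ?X \<and>
      (\<forall>\<alpha>\<in>spc A. \<forall>\<beta>\<in>spc B. \<forall>\<delta>\<in>spc D.
        h (pure C (tens C A B) D (pure C A B \<alpha> \<beta>) \<delta>) =
        pure C A (tens C B D) \<alpha> (pure C B D \<beta> \<delta>))"
  proof (rule ex1I[of _ h], goal_cases)
    case 1
    show ?case using h G o by (auto simp: pure_mem)
  next
    case (2 h')
    show ?case
    proof (rule tensor_lin_eqI[OF AB o(3)])
      fix \<omega> \<delta> assume m: "\<omega> \<in> T A B" "\<delta> \<in> spc D"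
      show "h' (pure C (tens C A B) D \<omega> \<delta>) = h (pure C (tens C A B) D \<omega> \<delta>)"
        using o(1,2) m(1)
      proof (induction rule: tensor_induct)
        case (pure \<alpha> \<beta>)
        then show ?case using 2 h G m o by (auto simp: pure_mem)
      next
        case (add \<omega> \<omega>')
        then show ?case
          using 2 h(1) m AB o(3)
          by (auto simp: bilinD[OF pure_bilin[OF AB o(3)]] lin_add pure_mem)
      qed
    qed (use 2 h in auto)
  qed
  from theI'[OF this] show "assoc C A B D \<in> lin (T (tens C A B) D) (T A (tens C B D))"
    "\<alpha> \<in> spc A \<Longrightarrow> \<beta> \<in> spc B \<Longrightarrow> \<delta> \<in> spc D \<Longrightarrow>
      assoc C A B D (pure C (tens C A B) D (pure C A B \<alpha> \<beta>) \<delta>) =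
      pure C A (tens C B D) \<alpha> (pure C B D \<beta> \<delta>)"
    by (auto simp: assoc_def)
qed

section \<open>Inverses of the canonical isomorphisms\<close>

text \<open>The inverse morphism in the category agrees with the set-theoretic inverse on the space
  and, like it, is 0 elsewhere; so the latter is a morphism.\<close>

lemma
  assumes "X \<in> objs C" "Y \<in> objs C" "iso_in C X Y f"
  shows linv_hom: "linv (spc X) (spc Y) f \<in> homs C Y X"
    and linv_apply: "x \<in> spc X \<Longrightarrow> linv (spc X) (spc Y) f (f x) = x"
proof -
  obtain g where f: "f \<in> homs C X Y" and g: "g \<in> homs C Y X"
    "g \<circ> f = idmap (spc X)" "f \<circ> g = idmap (spc Y)"
    using assms by (auto simp: iso_in_def)
  have fl: "f \<in> lin (spc X) (spc Y)" and gl: "g \<in> lin (spc Y) (spc X)"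
    using assms f g homs_lin by auto
  have gf: "g (f x) = x" if "x \<in> spc X" for x
    using g(2) that by (auto simp: fun_eq_iff idmap_def)
  have fg: "f (g y) = y" if "y \<in> spc Y" for y
    using g(3) that by (auto simp: fun_eq_iff idmap_def)
  have inj: "inj_on f (spc X)" by (rule inj_on_inverseI[of _ g]) (rule gf)
  have "linv (spc X) (spc Y) f = g"
  proof
    fix y
    show "linv (spc X) (spc Y) f y = g y"
    proof (cases "y \<in> spc Y")
      case True
      then have "inv_into (spc X) f y = g y"
        using inj fg lin_mem[OF gl] by (metis inv_into_f_f)
      then show ?thesis using True by (simp add: linv_def)
    qed (simp add: linv_def lin_outside[OF gl])
  qed
  then show "linv (spc X) (spc Y) f \<in> homs C Y X"
    "x \<in> spc X \<Longrightarrow> linv (spc X) (spc Y) f (f x) = x"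
    using g gf by auto
qed

lemma
  assumes "A \<in> objs C"
  shows lunit_iso: "iso_in C (tens C (Iobj C) A) A (lunit C A)"
    and runit_iso: "iso_in C (tens C A (Iobj C)) A (runit C A)"
  using monoidal assms by (simp_all add: monoidal_category_of_coms_def)

lemma lunit_hom: "A \<in> objs C \<Longrightarrow> lunit C A \<in> homs C (tens C (Iobj C) A) A"
  using lunit_iso by (simp add: iso_in_def)

lemma assoc_iso:
  "A \<in> objs C \<Longrightarrow> B \<in> objs C \<Longrightarrow> D \<in> objs C \<Longrightarrow>
    iso_in C (tens C (tens C A B) D) (tens C A (tens C B D)) (assoc C A B D)"
  using monoidal by (simp add: monoidal_category_of_coms_def)

lemma
  assumes A: "A \<in> objs C"
  shows lunit_inv_hom: "lunit_inv C A \<in> homs C A (tens C (Iobj C) A)"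
    and lunit_inv_apply: "\<alpha> \<in> spc A \<Longrightarrow> lunit_inv C A \<alpha> = pure C (Iobj C) A (evec C) \<alpha>"
proof -
  note l = tens_obj[OF Iobj_obj A] A lunit_iso[OF A]
  show "lunit_inv C A \<in> homs C A (tens C (Iobj C) A)"
    using linv_hom[OF l] by (simp add: lunit_inv_def)
  show "lunit_inv C A \<alpha> = pure C (Iobj C) A (evec C) \<alpha>" if "\<alpha> \<in> spc A"
    using linv_apply[OF l pure_mem[OF Iobj_obj A evec_spc that]] lunit_pure[OF A that, of 1]
    by (simp add: lunit_inv_def)
qed

lemma
  assumes A: "A \<in> objs C"
  shows runit_inv_hom: "runit_inv C A \<in> homs C A (tens C A (Iobj C))"
    and runit_inv_apply: "\<alpha> \<in> spc A \<Longrightarrow> runit_inv C A \<alpha> = pure C A (Iobj C) \<alpha> (evec C)"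
proof -
  note l = tens_obj[OF A Iobj_obj] A runit_iso[OF A]
  show "runit_inv C A \<in> homs C A (tens C A (Iobj C))"
    using linv_hom[OF l] by (simp add: runit_inv_def)
  show "runit_inv C A \<alpha> = pure C A (Iobj C) \<alpha> (evec C)" if "\<alpha> \<in> spc A"
    using linv_apply[OF l pure_mem[OF A Iobj_obj that evec_spc]] runit_pure[OF A that, of 1]
    by (simp add: runit_inv_def)
qed

lemma
  assumes o: "A \<in> objs C" "B \<in> objs C" "D \<in> objs C"
  shows assoc_inv_lin: "assoc_inv C A B D \<in> lin (T A (tens C B D)) (T (tens C A B) D)"
    and assoc_inv_pure: "\<alpha> \<in> spc A \<Longrightarrow> \<beta> \<in> spc B \<Longrightarrow> \<delta> \<in> spc D \<Longrightarrow>
      assoc_inv C A B D (pure C A (tens C B D) \<alpha> (pure C B D \<beta> \<delta>)) =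
      pure C (tens C A B) D (pure C A B \<alpha> \<beta>) \<delta>"
proof -
  note l = tens_obj[OF tens_obj[OF o(1,2)] o(3)] tens_obj[OF o(1) tens_obj[OF o(2,3)]] assoc_iso[OF o]
  show "assoc_inv C A B D \<in> lin (T A (tens C B D)) (T (tens C A B) D)"
    using homs_lin[OF l(2,1) linv_hom[OF l]] by (simp add: assoc_inv_def)
  show "assoc_inv C A B D (pure C A (tens C B D) \<alpha> (pure C B D \<beta> \<delta>)) =
      pure C (tens C A B) D (pure C A B \<alpha> \<beta>) \<delta>" if m: "\<alpha> \<in> spc A" "\<beta> \<in> spc B" "\<delta> \<in> spc D"
    using linv_apply[OF l pure_mem[OF tens_obj[OF o(1,2)] o(3) pure_mem[OF o(1,2) m(1,2)] m(3)]]
      assoc_pure[OF o m]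
    by (simp add: assoc_inv_def)
qed

section \<open>Hats and zigzags\<close>

context
  fixes A :: "'v com"
  assumes A: "A \<in> objs C"
begin

lemma state_hat_pure:
  assumes "a \<in> dual (spc A)" "x \<in> spc A" "y \<in> spc A"
  shows "state_hat C A A (pure C A A x y) a = a x *\<^sub>R y"
  using assms effect_mor_lin[OF assms(1)] A
  by (simp add: state_hat_def tmap_pure Iobj_obj idmap_lin subspace_spc idmap_apply)
    (simp add: effect_mor_def lunit_pure)

lemma state_hat_add:
  assumes "a \<in> dual (spc A)" "\<omega> \<in> T A A" "\<omega>' \<in> T A A"
  shows "state_hat C A A (\<omega> + \<omega>') a = state_hat C A A \<omega> a + state_hat C A A \<omega>' a"
proof -
  note t = tmap_lin[OF A Iobj_obj A A effect_mor_lin[OF assms(1)] idmap_lin[OF subspace_spc[OF A]]]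
  show ?thesis
    using assms by (simp add: state_hat_def lin_add[OF t] lin_add[OF lunit_lin[OF A]] lin_mem[OF t])
qed

lemma state_hat_mem:
  assumes "a \<in> dual (spc A)" "\<omega> \<in> T A A"
  shows "state_hat C A A \<omega> a \<in> spc A"
proof -
  note t = tmap_lin[OF A Iobj_obj A A effect_mor_lin[OF assms(1)] idmap_lin[OF subspace_spc[OF A]]]
  show ?thesis
    using assms by (simp add: state_hat_def lin_mem[OF t] lin_mem[OF lunit_lin[OF A]])
qed

text \<open>The functional sits inside a definite description, so linearity in it is checked on
  product vectors, where the value is \<open>a x *\<^sub>R y\<close>, and carried over by additivity
  in the state.\<close>

lemma state_hat_lin:
  assumes "\<omega> \<in> T A A"
  shows "state_hat C A A \<omega> \<in> lin (dual (spc A)) (spc A)"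
proof (rule linI)
  fix a b and c :: real assume a: "a \<in> dual (spc A)"
  \<comment> \<open>The scaled functional gets a name so that it enters
    \<open>state_hat_pure\<close> as a single functional; its pointwise law is supplied
    separately.\<close>
  define d where "d = c *\<^sub>R a"
  have d: "d \<in> dual (spc A)" "\<And>x. d x = c * a x"
    using subspace_scale[OF subspace_dual a] by (simp_all add: d_def scaleR_fun_def)
  have "state_hat C A A \<omega> d = c *\<^sub>R state_hat C A A \<omega> a"
    using A A assms
  proof (induction rule: tensor_induct)
    case (pure \<alpha> \<beta>)
    then show ?case using a d(1) by (simp add: state_hat_pure d(2)[of \<alpha>] scaleR_left_distrib)
  next
    case (add \<omega> \<omega>')
    then show ?case using a d(1) by (simp add: state_hat_add scaleR_add_right)
  qed
  then show "state_hat C A A \<omega> (c *\<^sub>R a) = c *\<^sub>R state_hat C A A \<omega> a" by (simp only: d_def)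
  assume b: "b \<in> dual (spc A)"
  define e where "e = a + b"
  have e: "e \<in> dual (spc A)" "\<And>x. e x = a x + b x"
    using subspace_add[OF subspace_dual a b] by (simp_all add: e_def)
  have "state_hat C A A \<omega> e = state_hat C A A \<omega> a + state_hat C A A \<omega> b"
    using A A assms
  proof (induction rule: tensor_induct)
    case (pure \<alpha> \<beta>)
    then show ?case using a b e(1) by (simp add: state_hat_pure e(2)[of \<alpha>] scaleR_left_distrib)
  next
    case (add \<omega> \<omega>')
    then show ?case using a b e(1) by (simp add: state_hat_add scaleR_add_right)
  qed
  then show "state_hat C A A \<omega> (a + b) = state_hat C A A \<omega> a + state_hat C A A \<omega> b"
    by (simp only: e_def)
qed (use assms in \<open>auto simp: state_hat_mem\<close>, simp add: state_hat_def)

lemma effect_hat_dual: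
  assumes "f \<in> dual (T A A)" "\<alpha> \<in> spc A"
  shows "effect_hat C A A f \<alpha> \<in> dual (spc A)"
  unfolding dual_def
  using assms(1,2) A
  by (intro linI)
    (auto simp: effect_hat_def bilinD[OF pure_bilin[OF A A]] subspace_add subspace_scale
      subspace_spc dual_def lin_add lin_scale pure_mem)

text \<open>\<open>zig\<close> and \<open>zag\<close> are the left-hand sides of the two zigzag identities for \<open>A' = A\<close>.\<close>

definition zig :: "'v \<Rightarrow> ('v \<Rightarrow> real) \<Rightarrow> 'v \<Rightarrow> 'v" where
  "zig \<gamma> f = lunit C A
       \<circ> tmap C (tens C A A) (Iobj C) A A (effect_mor C f) (idmap (spc A))
       \<circ> assoc_inv C A A A
       \<circ> tmap C A A (Iobj C) (tens C A A) (idmap (spc A)) (state_mor C \<gamma>)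
       \<circ> runit_inv C A"

definition zag :: "'v \<Rightarrow> ('v \<Rightarrow> real) \<Rightarrow> 'v \<Rightarrow> 'v" where
  "zag \<gamma> f = runit C A
       \<circ> tmap C A A (tens C A A) (Iobj C) (idmap (spc A)) (effect_mor C f)
       \<circ> assoc C A A A
       \<circ> tmap C (Iobj C) (tens C A A) A A (state_mor C \<gamma>) (idmap (spc A))
       \<circ> lunit_inv C A"

lemmas AA = tens_obj[OF A A]

lemma id_lin: "idmap (spc A) \<in> lin (spc A) (spc A)"
  by (rule idmap_lin[OF subspace_spc[OF A]])

text \<open>Both sides are additive in \<gamma>. For \<gamma> the product of \<open>x\<close> and
  \<open>y\<close>, reassociation pairs \<alpha> with \<open>x\<close>, and both sides become
  \<open>f (pure C A A \<alpha> x) *\<^sub>R y\<close>.\<close>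

lemma zig_eq:
  assumes "f \<in> dual (T A A)" "\<gamma> \<in> T A A" "\<alpha> \<in> spc A"
  shows "zig \<gamma> f \<alpha> = state_hat C A A \<gamma> (effect_hat C A A f \<alpha>)"
proof -
  note fl = effect_mor_lin[OF assms(1)]
  note gl = state_mor_lin[OF subspace_spc[OF AA] assms(2)]
  note t = tmap_lin[OF AA Iobj_obj A A fl id_lin]
  \<comment> \<open>The chain after the state has been inserted, as a function of the inserted
    vector, so that the induction acts on an argument instead of on a morphism.\<close>
  define Z where "Z \<omega> = lunit C A (tmap C (tens C A A) (Iobj C) A A (effect_mor C f) (idmap (spc A))
      (assoc_inv C A A A (pure C A (tens C A A) \<alpha> \<omega>)))" for \<omega>
  have "zig \<gamma> f \<alpha> = Z \<gamma>"
    using assms(3)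
    by (simp add: zig_def Z_def runit_inv_apply[OF A] tmap_pure[OF A A Iobj_obj AA id_lin gl]
        evec_spc state_mor_evec idmap_apply)
  also have "Z \<gamma> = state_hat C A A \<gamma> (effect_hat C A A f \<alpha>)"
    using A A assms(2)
  proof (induction rule: tensor_induct)
    case (pure x y)
    then show ?case
      using assms A
      by (simp add: Z_def assoc_inv_pure tmap_pure[OF AA Iobj_obj A A fl id_lin] pure_mem
          state_hat_pure effect_hat_dual idmap_apply)
        (simp add: effect_mor_def lunit_pure effect_hat_def)
  next
    case (add \<omega> \<omega>')
    have "Z (\<omega> + \<omega>') = Z \<omega> + Z \<omega>'"
      using add(1,2) assms(3)
      by (simp add: Z_def bilinD[OF pure_bilin[OF A AA]] pure_mem[OF A AA]
          lin_add[OF assoc_inv_lin[OF A A A]] lin_mem[OF assoc_inv_lin[OF A A A]]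
          lin_add[OF t] lin_mem[OF t] lin_add[OF lunit_lin[OF A]])
    then show ?case using add assms by (simp add: state_hat_add effect_hat_dual)
  qed
  finally show ?thesis .
qed

lemma zag_mem:
  assumes "f \<in> dual (T A A)" "\<gamma> \<in> T A A" "\<beta> \<in> spc A"
  shows "zag \<gamma> f \<beta> \<in> spc A"
  unfolding zag_def comp_def
  by (intro lin_mem[OF runit_lin[OF A]]
      lin_mem[OF tmap_lin[OF A A AA Iobj_obj id_lin effect_mor_lin[OF assms(1)]]]
      lin_mem[OF assoc_lin[OF A A A]]
      lin_mem[OF tmap_lin[OF Iobj_obj AA A A state_mor_lin[OF subspace_spc[OF AA] assms(2)] id_lin]]
      lin_mem[OF homs_lin[OF A tens_obj[OF Iobj_obj A] lunit_inv_hom[OF A]]] assms(3))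

text \<open>For \<gamma> the product of \<open>x\<close> and \<open>y\<close>, the second zigzag
  sends \<beta> to \<open>f (pure C A A y \<beta>) *\<^sub>R x\<close>. Applying \<open>a\<close>
  moves the scalar \<open>a x\<close> into the first argument of \<open>f\<close>, where it forms
  the hat of \<gamma> at \<open>a\<close>.\<close>

lemma dual_zag:
  assumes "f \<in> dual (T A A)" "\<gamma> \<in> T A A" "\<beta> \<in> spc A" "a \<in> dual (spc A)"
  shows "a (zag \<gamma> f \<beta>) = effect_hat C A A f (state_hat C A A \<gamma> a) \<beta>"
proof -
  note fl = effect_mor_lin[OF assms(1)]
  note gl = state_mor_lin[OF subspace_spc[OF AA] assms(2)]
  note t = tmap_lin[OF A A AA Iobj_obj id_lin fl]
  have al: "a \<in> lin (spc A) UNIV" and ff: "f \<in> lin (T A A) UNIV"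
    using assms by (auto simp: dual_def)
  define Z where "Z \<omega> = runit C A (tmap C A A (tens C A A) (Iobj C) (idmap (spc A)) (effect_mor C f)
      (assoc C A A A (pure C (tens C A A) A \<omega> \<beta>)))" for \<omega>
  have "zag \<gamma> f \<beta> = Z \<gamma>"
    using assms(3)
    by (simp add: zag_def Z_def lunit_inv_apply[OF A] tmap_pure[OF Iobj_obj AA A A gl id_lin]
        evec_spc state_mor_evec idmap_apply)
  moreover have "a (Z \<gamma>) = effect_hat C A A f (state_hat C A A \<gamma> a) \<beta>"
    using A A assms(2)
  proof (induction rule: tensor_induct)
    case (pure x y)
    then have "a (Z (pure C A A x y)) = a (f (pure C A A y \<beta>) *\<^sub>R x)"
      using assms A
      by (simp add: Z_def assoc_pure tmap_pure[OF A A AA Iobj_obj id_lin fl] pure_mem idmap_apply)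
        (simp add: effect_mor_def runit_pure)
    also have "\<dots> = f (pure C A A (a x *\<^sub>R y) \<beta>)"
      using pure assms A
      by (simp add: lin_scale[OF al] bilinD[OF pure_bilin[OF A A]] lin_scale[OF ff] pure_mem)
    finally show ?case
      using pure assms A by (simp add: state_hat_pure effect_hat_def subspace_scale subspace_spc)
  next
    case (add \<omega> \<omega>')
    have p: "pure C (tens C A A) A \<omega> \<beta> \<in> T (tens C A A) A" "pure C (tens C A A) A \<omega>' \<beta> \<in> T (tens C A A) A"
      using add(1,2) assms(3) by (simp_all add: pure_mem[OF AA A])
    have "Z (\<omega> + \<omega>') = Z \<omega> + Z \<omega>'" "Z \<omega> \<in> spc A" "Z \<omega>' \<in> spc A"
      using add(1,2) assms(3) p
      by (simp_all add: Z_def bilinD[OF pure_bilin[OF AA A]]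
          lin_add[OF assoc_lin[OF A A A]] lin_mem[OF assoc_lin[OF A A A]]
          lin_add[OF t] lin_mem[OF t] lin_add[OF runit_lin[OF A]] lin_mem[OF runit_lin[OF A]])
    \<comment> \<open>A sum of states makes the hat of the state a sum of vectors, which must then
      be split inside the effect.\<close>
    moreover have "effect_hat C A A f (x + y) \<beta> = effect_hat C A A f x \<beta> + effect_hat C A A f y \<beta>"
      if "x \<in> spc A" "y \<in> spc A" for x y
      using that assms(3) A
      by (simp add: effect_hat_def subspace_add subspace_spc bilinD[OF pure_bilin[OF A A]]
          lin_add[OF ff] pure_mem)
    ultimately show ?case
      using add assms by (simp add: lin_add[OF al] state_hat_add state_hat_mem)
  qed
  ultimately show ?thesis by simp
qed

section \<open>Zigzags, positivity and order isomorphisms\<close>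

lemma is_dual_self_iff:
  assumes "\<gamma> \<in> pcone (tens C A A)" "f \<in> econe (tens C A A)"
  shows "is_dual C A A (state_mor C \<gamma>) (effect_mor C f) \<longleftrightarrow>
    (\<forall>\<alpha>\<in>spc A. state_hat C A A \<gamma> (effect_hat C A A f \<alpha>) = \<alpha>) \<and>
    (\<forall>a\<in>dual (spc A). effect_hat C A A f (state_hat C A A \<gamma> a) = a)"
proof -
  have f: "f \<in> dual (T A A)" and \<gamma>: "\<gamma> \<in> T A A"
    using assms pcone_spc[OF AA] econe_dual[OF AA] by auto
  note fl = effect_mor_lin[OF f]
  note gl = state_mor_lin[OF subspace_spc[OF AA] \<gamma>]
  \<comment> \<open>Off the space both the zigzag and the identity are 0, so equality of functions
    reduces to equality on \<open>spc A\<close>.\<close>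
  have "zig \<gamma> f x = 0" if "x \<notin> spc A" for x
    using lin_outside[OF homs_lin[OF A tens_obj[OF A Iobj_obj] runit_inv_hom[OF A]] that]
    by (simp add: zig_def lin_zero[OF tmap_lin[OF A A Iobj_obj AA id_lin gl]]
        lin_zero[OF assoc_inv_lin[OF A A A]] lin_zero[OF tmap_lin[OF AA Iobj_obj A A fl id_lin]]
        lin_zero[OF lunit_lin[OF A]])
  then have zig: "zig \<gamma> f = idmap (spc A) \<longleftrightarrow>
      (\<forall>\<alpha>\<in>spc A. state_hat C A A \<gamma> (effect_hat C A A f \<alpha>) = \<alpha>)"
    by (auto simp: fun_eq_iff idmap_def zig_eq[OF f \<gamma>])
  have "zag \<gamma> f x = 0" if "x \<notin> spc A" for x
    using lin_outside[OF homs_lin[OF A tens_obj[OF Iobj_obj A] lunit_inv_hom[OF A]] that]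
    by (simp add: zag_def lin_zero[OF tmap_lin[OF Iobj_obj AA A A gl id_lin]]
        lin_zero[OF assoc_lin[OF A A A]] lin_zero[OF tmap_lin[OF A A AA Iobj_obj id_lin fl]]
        lin_zero[OF runit_lin[OF A]])
  then have "zag \<gamma> f = idmap (spc A) \<longleftrightarrow> (\<forall>\<beta>\<in>spc A. zag \<gamma> f \<beta> = \<beta>)"
    by (auto simp: fun_eq_iff idmap_def)
  \<comment> \<open>Testing against all functionals turns the identity on vectors into one on
    functionals, after which the roles of \<beta> and \<open>a\<close> are exchanged.\<close>
  also have "\<dots> \<longleftrightarrow> (\<forall>\<beta>\<in>spc A. \<forall>a\<in>dual (spc A). a (zag \<gamma> f \<beta>) = a \<beta>)"
    using dual_separates[OF fin_dim[OF A] zag_mem[OF f \<gamma>]] by auto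
  also have "\<dots> \<longleftrightarrow> (\<forall>\<beta>\<in>spc A. \<forall>a\<in>dual (spc A).
      effect_hat C A A f (state_hat C A A \<gamma> a) \<beta> = a \<beta>)"
    using dual_zag[OF f \<gamma>] by auto
  also have "\<dots> \<longleftrightarrow> (\<forall>a\<in>dual (spc A). effect_hat C A A f (state_hat C A A \<gamma> a) = a)"
    using lin_eqI[of _ "spc A" UNIV _ UNIV] effect_hat_dual[OF f] state_hat_mem[OF _ \<gamma>]
    unfolding dual_def by (metis (no_types, lifting))
  finally have zag: "zag \<gamma> f = idmap (spc A) \<longleftrightarrow>
      (\<forall>a\<in>dual (spc A). effect_hat C A A f (state_hat C A A \<gamma> a) = a)" .
  show ?thesis
    using A assms homs_from_I[OF AA] homs_to_I[OF AA] zig zag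
    by (auto simp: is_dual_def zig_def zag_def)
qed

text \<open>Composing the state with the effect on one factor gives a morphism from the unit model
  to \<open>A\<close>, and such morphisms are exactly the elements of
  \<open>pcone A\<close>.\<close>

lemma state_hat_pos:
  assumes "\<gamma> \<in> pcone (tens C A A)" "a \<in> econe A"
  shows "state_hat C A A \<gamma> a \<in> pcone A"
proof -
  note IA = tens_obj[OF Iobj_obj A]
  have "effect_mor C a \<in> homs C A (Iobj C)" "state_mor C \<gamma> \<in> homs C (Iobj C) (tens C A A)"
    using assms homs_to_I[OF A] homs_from_I[OF AA] by auto
  then have "lunit C A \<circ> tmap C A (Iobj C) A A (effect_mor C a) (idmap (spc A)) \<circ> state_mor C \<gamma>
      \<in> homs C (Iobj C) A"
    by (intro homs_comp[OF Iobj_obj AA A] homs_comp[OF AA IA A] lunit_hom[OF A]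
        homs_tmap[OF A Iobj_obj A A] homs_id[OF A])
  then obtain \<alpha> where "\<alpha> \<in> pcone A"
    "lunit C A \<circ> tmap C A (Iobj C) A A (effect_mor C a) (idmap (spc A)) \<circ> state_mor C \<gamma> = state_mor C \<alpha>"
    unfolding homs_from_I[OF A] by blast
  moreover from fun_cong[OF this(2), of "evec C"] have "state_hat C A A \<gamma> a = \<alpha>"
    using assms econe_dual[OF A] by (simp add: state_mor_evec state_hat_def)
  ultimately show ?thesis by simp
qed

text \<open>Inserting the state \<alpha> into the first factor gives a morphism from
  \<open>A\<close> to the unit model, and such morphisms are exactly the elements of
  \<open>econe A\<close>.\<close>

lemma effect_hat_pos:
  assumes "f \<in> econe (tens C A A)" "\<alpha> \<in> pcone A"
  shows "effect_hat C A A f \<alpha> \<in> econe A"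
proof -
  note IA = tens_obj[OF Iobj_obj A]
  have \<alpha>: "\<alpha> \<in> spc A" and f: "f \<in> dual (T A A)"
    using assms pcone_spc[OF A] econe_dual[OF AA] by auto
  have "effect_mor C f \<in> homs C (tens C A A) (Iobj C)" "state_mor C \<alpha> \<in> homs C (Iobj C) A"
    using assms homs_to_I[OF AA] homs_from_I[OF A] by auto
  then have "effect_mor C f \<circ> (tmap C (Iobj C) A A A (state_mor C \<alpha>) (idmap (spc A)) \<circ> lunit_inv C A)
      \<in> homs C A (Iobj C)"
    by (intro homs_comp[OF A AA Iobj_obj] homs_comp[OF A IA AA] lunit_inv_hom[OF A]
        homs_tmap[OF Iobj_obj A A A] homs_id[OF A])
  then obtain a where a: "a \<in> econe A"
    "effect_mor C f \<circ> (tmap C (Iobj C) A A A (state_mor C \<alpha>) (idmap (spc A)) \<circ> lunit_inv C A) = effect_mor C a"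
    unfolding homs_to_I[OF A] by blast
  have "effect_hat C A A f \<alpha> = a"
  proof (rule lin_eqI[of _ "spc A" UNIV _ UNIV])
    show "effect_hat C A A f \<alpha> \<in> lin (spc A) UNIV" "a \<in> lin (spc A) UNIV"
      using effect_hat_dual[OF f \<alpha>] econe_dual[OF A a(1)] by (auto simp: dual_def)
    show "effect_hat C A A f \<alpha> \<beta> = a \<beta>" if "\<beta> \<in> spc A" for \<beta>
      \<comment> \<open>Both sides are multiples of \<open>evec C\<close>, which is nonzero and can
        be cancelled.\<close>
      using fun_cong[OF a(2), of \<beta>] that \<alpha> evec_nz
      by (simp add: lunit_inv_apply[OF A] evec_spc state_mor_evec idmap_apply effect_mor_def effect_hat_def
          tmap_pure[OF Iobj_obj A A A state_mor_lin[OF subspace_spc[OF A] \<alpha>] id_lin])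
  qed
  then show ?thesis using a by simp
qed

lemma isomorphism_state_iff:
  assumes "\<gamma> \<in> pcone (tens C A A)" "f \<in> econe (tens C A A)"
  shows "isomorphism_state C A \<gamma> \<and>
      effect_hat C A A f = linv (dual (spc A)) (spc A) (state_hat C A A \<gamma>) \<longleftrightarrow>
    is_dual C A A (state_mor C \<gamma>) (effect_mor C f)"
    (is "?L \<longleftrightarrow> ?R")
proof -
  have f: "f \<in> dual (T A A)" and \<gamma>: "\<gamma> \<in> T A A"
    using assms pcone_spc[OF AA] econe_dual[OF AA] by auto
  let ?g = "state_hat C A A \<gamma>" and ?f = "effect_hat C A A f"
  show ?thesis
    unfolding is_dual_self_iff[OF assms]
  proof (intro iffI)
    assume ?L
    then have bij: "bij_betw ?g (dual (spc A)) (spc A)"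
      and inv: "\<And>\<alpha>. \<alpha> \<in> spc A \<Longrightarrow> ?f \<alpha> = inv_into (dual (spc A)) ?g \<alpha>"
      by (auto simp: isomorphism_state_def order_isomorphism_def linv_def)
    then show "(\<forall>\<alpha>\<in>spc A. ?g (?f \<alpha>) = \<alpha>) \<and> (\<forall>a\<in>dual (spc A). ?f (?g a) = a)"
      using bij_betw_inv_into_right[OF bij] bij_betw_inv_into_left[OF bij] state_hat_mem[OF _ \<gamma>]
      by auto
  next
    assume R: "(\<forall>\<alpha>\<in>spc A. ?g (?f \<alpha>) = \<alpha>) \<and> (\<forall>a\<in>dual (spc A). ?f (?g a) = a)"
    then have bij: "bij_betw ?g (dual (spc A)) (spc A)"
      using state_hat_mem[OF _ \<gamma>] effect_hat_dual[OF f] by (intro bij_betw_byWitness[of _ ?f]) auto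
    have "?g ` econe A = pcone A"
    proof
      show "?g ` econe A \<subseteq> pcone A" using state_hat_pos[OF assms(1)] by auto
      \<comment> \<open>A positive \<alpha> is the image of its effect hat, which is positive as
        well; this is where positivity of the inverse enters.\<close>
      show "pcone A \<subseteq> ?g ` econe A"
        using effect_hat_pos[OF assms(2)] R pcone_spc[OF A] by (metis image_eqI subsetI)
    qed
    moreover have "?f = linv (dual (spc A)) (spc A) ?g"
    proof
      fix \<alpha>
      show "?f \<alpha> = linv (dual (spc A)) (spc A) ?g \<alpha>"
      proof (cases "\<alpha> \<in> spc A")
        case True
        then have "inv_into (dual (spc A)) ?g \<alpha> = ?f \<alpha>"
          using bij_betw_inv_into_left[OF bij effect_hat_dual[OF f True]] R by simp
        then show ?thesis using True by (simp add: linv_def)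
      qed (simp add: linv_def effect_hat_def fun_eq_iff)
    qed
    ultimately show ?L
      using bij state_hat_lin[OF \<gamma>] by (simp add: isomorphism_state_def order_isomorphism_def)
  qed
qed

text \<open>Morphisms from and to the unit model are all given by states and effects, so quantifying
  over units and counits loses and adds nothing.\<close>

lemma self_dual_iff:
  "(\<exists>\<gamma>\<in>pcone (tens C A A). \<exists>f\<in>econe (tens C A A).
      isomorphism_state C A \<gamma> \<and>
      effect_hat C A A f = linv (dual (spc A)) (spc A) (state_hat C A A \<gamma>)) \<longleftrightarrow>
    (\<exists>\<eta> \<epsilon>. is_dual C A A \<eta> \<epsilon>)"
proof -
  have "\<exists>\<gamma>\<in>pcone (tens C A A). \<exists>f\<in>econe (tens C A A). \<eta> = state_mor C \<gamma> \<and> \<epsilon> = effect_mor C f"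
    if "is_dual C A A \<eta> \<epsilon>" for \<eta> \<epsilon>
    using that homs_from_I[OF AA] homs_to_I[OF AA] by (auto simp: is_dual_def)
  then show ?thesis using isomorphism_state_iff by blast
qed

end

end

theorem theorem21:
  fixes C :: "'v::real_normed_vector com_cat"
  assumes "monoidal_category_of_coms C"
  shows "weakly_self_dual C \<longleftrightarrow>
    compact_closed C \<and>
    (\<exists>D \<eta> \<epsilon>. compact_structure C D \<eta> \<epsilon> \<and> (\<forall>A\<in>objs C. D A = A))"
proof -
  interpret monoidal_coms C by unfold_locales (rule assms)
  have "weakly_self_dual C \<longleftrightarrow> (\<forall>A\<in>objs C. \<exists>\<eta> \<epsilon>. is_dual C A A \<eta> \<epsilon>)"
    unfolding weakly_self_dual_def by (intro ball_cong refl self_dual_iff)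
  \<comment> \<open>The axiom of choice collects the separate duals into one family.\<close>
  also have "\<dots> \<longleftrightarrow> (\<exists>\<eta> \<epsilon>. \<forall>A\<in>objs C. is_dual C A A (\<eta> A) (\<epsilon> A))"
    by metis
  also have "\<dots> \<longleftrightarrow> compact_closed C \<and>
      (\<exists>D \<eta> \<epsilon>. compact_structure C D \<eta> \<epsilon> \<and> (\<forall>A\<in>objs C. D A = A))"
    (is "?self \<longleftrightarrow> compact_closed C \<and> ?str")
  proof
    assume ?self
    then obtain \<eta> \<epsilon> where "\<forall>A\<in>objs C. is_dual C A A (\<eta> A) (\<epsilon> A)" by blast
    then have "compact_closed C" "compact_structure C (\<lambda>A. A) \<eta> \<epsilon>"
      unfolding compact_closed_def compact_structure_def by blast+
    then show "compact_closed C \<and> ?str" by blast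
  next
    assume "compact_closed C \<and> ?str"
    then obtain D \<eta> \<epsilon> where "compact_structure C D \<eta> \<epsilon>" "\<forall>A\<in>objs C. D A = A" by blast
    then show ?self unfolding compact_structure_def by (intro exI[of _ \<eta>] exI[of _ \<epsilon>]) simp
  qed
  finally show ?thesis .
qed

end
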